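(* Let $M$ be a smooth, closed, oriented, finite-dimensional manifold, let $\mathcal{M}$ be the Fréchet manifold of smooth Riemannian metrics on $M$, and let $d$ be the distance function on $\mathcal{M}$ induced by the $L^2$ metric $(\cdot,\cdot)$. Then $(\mathcal{M}, d)$ is a metric space; in particular $d(g_0,g_1)>0$ whenever $g_0\neq g_1$.
   Context: Let $\mathcal{S}$ be the Fréchet space of smooth symmetric $(0,2)$-tensor fields on $M$ with the $C^\infty$ topology. $\mathcal{M}\subset\mathcal{S}$ is the open subset of smooth Riemannian metrics, so $T_g\mathcal{M}\cong\mathcal{S}$ for every $g\in\mathcal{M}$. The $L^2$ metric is the (weak) Riemannian metric on $\mathcal{M}$ given by $(h,k)_g=\int_M \operatorname{tr}_g(hk)\,\mu_g$ for $h,k\in\mathcal{S}$, where locally $\operatorname{tr}_g(hk)=\operatorname{tr}(g^{-1}hg^{-1}k)$ and $\mu_g$ is the volume form of $g$. Put $\|h\|_g=\sqrt{(h,h)_g}$. The length of a piecewise $C^1$ path $g_t$, $t\in[0,1]$, in $\mathcal{M}$ is $L(g_t)=\int_0^1\|g_t'\|_{g_t}\,dt$, and $d(g_0,g_1)$ is the infimum of the lengths of piecewise $C^1$ paths in $\mathcal{M}$ from $g_0$ to $g_1$. *)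

theory Defs
  imports "HOL-Analysis.Analysis"
begin

text \<open>
  The manifold is the whole of a type \<open>'a\<close> (Hausdorff, second countable), together with an oriented
  smooth atlas of charts into \<open>real ^ 'n\<close>. A chart is a pair of a domain and a coordinate map; the
  values of the coordinate map outside the domain are irrelevant.
\<close>

type_synonym ('a, 'n) chart = "'a set \<times> ('a \<Rightarrow> real ^ 'n)"

text \<open>The derivatives are two-sided, so both notions are meant for open \<open>S\<close> only.\<close>

primrec Ck_on :: "nat \<Rightarrow> 'a::real_normed_vector set \<Rightarrow> ('a \<Rightarrow> 'b::real_normed_vector) \<Rightarrow> bool" where
  "Ck_on 0 S f \<longleftrightarrow> continuous_on S f"
| "Ck_on (Suc k) S f \<longleftrightarrow> (\<forall>x\<in>S. f differentiable (at x)) \<and>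
     (\<forall>v. Ck_on k S (\<lambda>x. frechet_derivative f (at x) v))"

definition smooth_on :: "'a::real_normed_vector set \<Rightarrow> ('a \<Rightarrow> 'b::real_normed_vector) \<Rightarrow> bool" where
  "smooth_on S f \<longleftrightarrow> (\<forall>k. Ck_on k S f)"

primrec iter_partial :: "'n list \<Rightarrow> (real ^ 'n::finite \<Rightarrow> real) \<Rightarrow> real ^ 'n \<Rightarrow> real" where
  "iter_partial [] f = f"
| "iter_partial (i # is) f = (\<lambda>x. frechet_derivative (iter_partial is f) (at x) (axis i 1))"

definition coord_image :: "('a, 'n) chart \<Rightarrow> (real ^ 'n) set" where
  "coord_image c = snd c ` fst c"

definition transition :: "('a, 'n) chart \<Rightarrow> ('a, 'n) chart \<Rightarrow> real ^ 'n \<Rightarrow> real ^ 'n" where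
  "transition c c' = snd c' \<circ> inv_into (fst c) (snd c)"

definition overlap :: "('a, 'n) chart \<Rightarrow> ('a, 'n) chart \<Rightarrow> (real ^ 'n) set" where
  "overlap c c' = snd c ` (fst c \<inter> fst c')"

definition transition_jac :: "('a, 'n::finite) chart \<Rightarrow> ('a, 'n) chart \<Rightarrow> real ^ 'n \<Rightarrow> real ^ 'n ^ 'n" where
  "transition_jac c c' x = jacobian (transition c c') (at x)"

definition oriented_smooth_atlas :: "('a::topological_space, 'n::finite) chart set \<Rightarrow> bool" where
  "oriented_smooth_atlas A \<longleftrightarrow>
     (\<Union>c\<in>A. fst c) = UNIV \<and>
     (\<forall>c\<in>A. open (fst c) \<and> open (coord_image c) \<and>
        homeomorphism (fst c) (coord_image c) (snd c) (inv_into (fst c) (snd c))) \<and>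
     (\<forall>c\<in>A. \<forall>c'\<in>A. smooth_on (overlap c c') (transition c c') \<and>
        (\<forall>x\<in>overlap c c'. det (transition_jac c c' x) > 0))"

text \<open>
  A \<open>(0,2)\<close>-tensor field is given by its component matrices in all charts of the atlas, as functions of
  the coordinates, subject to the covariant transformation law. The components are set to zero where
  they have no meaning, so that two fields are equal iff they are equal as HOL functions.
\<close>

type_synonym ('a, 'n) field2 = "('a, 'n) chart \<Rightarrow> real ^ 'n \<Rightarrow> real ^ 'n ^ 'n"

definition sym_tensor_fields :: "('a, 'n::finite) chart set \<Rightarrow> ('a, 'n) field2 set" where
  "sym_tensor_fields A = {h.
     (\<forall>c\<in>A. smooth_on (coord_image c) (h c)) \<and>
     (\<forall>c\<in>A. \<forall>x\<in>coord_image c. transpose (h c x) = h c x) \<and>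
     (\<forall>c\<in>A. \<forall>c'\<in>A. \<forall>x\<in>overlap c c'.
        h c x = transpose (transition_jac c c' x) ** h c' (transition c c' x) ** transition_jac c c' x) \<and>
     (\<forall>c x. c \<notin> A \<or> x \<notin> coord_image c \<longrightarrow> h c x = 0)}"

definition riem_metrics :: "('a, 'n::finite) chart set \<Rightarrow> ('a, 'n) field2 set" where
  "riem_metrics A = {g \<in> sym_tensor_fields A.
     \<forall>c\<in>A. \<forall>x\<in>coord_image c. \<forall>v. v \<noteq> 0 \<longrightarrow> v \<bullet> (g c x *v v) > 0}"

text \<open>
  The topology of the seminorms \<open>sup |D (h i j)|\<close>, where the sup is taken over a compact subset of a
  coordinate domain and \<open>D\<close> is an iterated partial derivative.
\<close>

definition smooth_topology :: "('a, 'n::finite) chart set \<Rightarrow> ('a, 'n) field2 topology" where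
  "smooth_topology A = topology_generated_by
     {{k \<in> sym_tensor_fields A. \<forall>x\<in>K.
         \<bar>iter_partial is (\<lambda>y. k c y $ i $ j) x - iter_partial is (\<lambda>y. h c y $ i $ j) x\<bar> < e}
      | h c K is i j e. h \<in> sym_tensor_fields A \<and> c \<in> A \<and> compact K \<and> K \<subseteq> coord_image c \<and> e > 0}"

text \<open>
  The integral of a top-degree form over the oriented closed manifold; \<open>\<omega> c\<close> is the coefficient of
  \<open>dx\<^sup>1 \<and> \<dots> \<and> dx\<^sup>n\<close> in the (positively oriented) chart \<open>c\<close>. The manifold is cut into finitely many
  disjoint Borel pieces, each with closure inside one chart domain, and the coordinate integrals over
  the pieces are added up. By the change of variables formula the result does not depend on the
  partition if \<open>\<omega>\<close> is a continuous form on a compact manifold.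
\<close>

definition chart_partition :: "('a::topological_space, 'n) chart set \<Rightarrow> (('a, 'n) chart \<times> 'a set) set \<Rightarrow> bool" where
  "chart_partition A P \<longleftrightarrow> finite P \<and>
     (\<forall>(c, B)\<in>P. c \<in> A \<and> B \<in> sets borel \<and> closure B \<subseteq> fst c) \<and>
     disjoint_family_on snd P \<and> (\<Union>(c, B)\<in>P. B) = UNIV"

definition integral_form ::
    "('a::topological_space, 'n::finite) chart set \<Rightarrow> (('a, 'n) chart \<Rightarrow> real ^ 'n \<Rightarrow> real) \<Rightarrow> real" where
  "integral_form A \<omega> =
     (\<Sum>(c, B)\<in>(SOME P. chart_partition A P). set_lebesgue_integral lborel (snd c ` B) (\<omega> c))"

definition volume_form :: "('a, 'n::finite) field2 \<Rightarrow> ('a, 'n) chart \<Rightarrow> real ^ 'n \<Rightarrow> real" where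
  "volume_form g c x = sqrt (det (g c x))"

definition tr_prod :: "('a, 'n::finite) field2 \<Rightarrow> ('a, 'n) field2 \<Rightarrow> ('a, 'n) field2 \<Rightarrow>
    ('a, 'n) chart \<Rightarrow> real ^ 'n \<Rightarrow> real" where
  "tr_prod g h k c x = trace (matrix_inv (g c x) ** h c x ** matrix_inv (g c x) ** k c x)"

definition L2_inner :: "('a::topological_space, 'n::finite) chart set \<Rightarrow>
    ('a, 'n) field2 \<Rightarrow> ('a, 'n) field2 \<Rightarrow> ('a, 'n) field2 \<Rightarrow> real" where
  "L2_inner A g h k = integral_form A (\<lambda>c x. tr_prod g h k c x * volume_form g c x)"

definition L2_norm :: "('a::topological_space, 'n::finite) chart set \<Rightarrow>
    ('a, 'n) field2 \<Rightarrow> ('a, 'n) field2 \<Rightarrow> real" where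
  "L2_norm A g h = sqrt (L2_inner A g h h)"

text \<open>Derivative of a curve in the Frechet space of symmetric tensor fields, one-sided at end points of \<open>I\<close>.\<close>

definition has_velocity :: "('a, 'n::finite) chart set \<Rightarrow> (real \<Rightarrow> ('a, 'n) field2) \<Rightarrow>
    ('a, 'n) field2 \<Rightarrow> real \<Rightarrow> real set \<Rightarrow> bool" where
  "has_velocity A \<gamma> v t I \<longleftrightarrow>
     limitin (smooth_topology A) (\<lambda>s c x. (\<gamma> s c x - \<gamma> t c x) /\<^sub>R (s - t)) v (at t within I)"

definition C1_curve_on :: "('a, 'n::finite) chart set \<Rightarrow> real set \<Rightarrow> (real \<Rightarrow> ('a, 'n) field2) \<Rightarrow> bool" where
  "C1_curve_on A I \<gamma> \<longleftrightarrow>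
     (\<exists>\<gamma>'. (\<forall>t\<in>I. has_velocity A \<gamma> (\<gamma>' t) t I) \<and> continuous_map (top_of_set I) (smooth_topology A) \<gamma>')"

definition piecewise_C1_path :: "('a, 'n::finite) chart set \<Rightarrow> (real \<Rightarrow> ('a, 'n) field2) \<Rightarrow> bool" where
  "piecewise_C1_path A \<gamma> \<longleftrightarrow>
     (\<forall>t\<in>{0..1}. \<gamma> t \<in> riem_metrics A) \<and>
     (\<exists>T. finite T \<and> {0, 1} \<subseteq> T \<and> T \<subseteq> {0..1} \<and>
        (\<forall>a\<in>T. \<forall>b\<in>T. a < b \<and> {a<..<b} \<inter> T = {} \<longrightarrow> C1_curve_on A {a..b} \<gamma>))"

text \<open>The velocity is unspecified at the finitely many break points, which do not affect the length.\<close>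

definition velocity :: "('a, 'n::finite) chart set \<Rightarrow> (real \<Rightarrow> ('a, 'n) field2) \<Rightarrow> real \<Rightarrow> ('a, 'n) field2" where
  "velocity A \<gamma> t = (THE v. has_velocity A \<gamma> v t {0..1})"

definition L2_length :: "('a::topological_space, 'n::finite) chart set \<Rightarrow> (real \<Rightarrow> ('a, 'n) field2) \<Rightarrow> real" where
  "L2_length A \<gamma> = integral {0..1} (\<lambda>t. L2_norm A (\<gamma> t) (velocity A \<gamma> t))"

text \<open>
  The value zero off the metrics is a convention needed because the locale \<^locale>\<open>Metric_space\<close> asks for
  nonnegativity and symmetry on the whole type, not only on the carrier.
\<close>

definition L2_dist :: "('a::topological_space, 'n::finite) chart set \<Rightarrow>
    ('a, 'n) field2 \<Rightarrow> ('a, 'n) field2 \<Rightarrow> real" where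
  "L2_dist A g0 g1 =
     (if g0 \<in> riem_metrics A \<and> g1 \<in> riem_metrics A
      then Inf {L2_length A \<gamma> | \<gamma>. piecewise_C1_path A \<gamma> \<and> \<gamma> 0 = g0 \<and> \<gamma> 1 = g1}
      else 0)"

end

theory Submission
  imports Defs
begin

text \<open>
  The only hard point is that distinct metrics have positive distance. On positive definite matrices put
  \<open>F\<^sub>v(G) = (det G) powr (1/4) / (1 + v \<bullet> G v)\<close>. These functions separate points, and for every \<open>v\<close>
  the derivative in direction \<open>h\<close> satisfies \<open>|dF\<^sub>v(h)|\<^sup>2 \<le> (n + 2) tr(G\<^sup>-\<^sup>1 h G\<^sup>-\<^sup>1 h) sqrt(det G)\<close>, whose right
  side is, up to the factor, the density of the \<open>L\<^sup>2\<close> metric. Integrating along a path and applying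
  Cauchy-Schwarz over a piece \<open>E\<close> of the partition that computes the integral shows that the \<open>L\<^sup>2(E)\<close>
  norm of \<open>F\<^sub>v(g\<^sub>1) - F\<^sub>v(g\<^sub>0)\<close> is at most \<open>sqrt(n + 2)\<close> times the length of the path. So at distance
  zero the two metrics agree almost everywhere on every piece, hence everywhere by continuity.
\<close>

section \<open>Positive definite matrices\<close>

text \<open>The obstacle is that the metric is weak: its norm does not control the smooth topology,
  and metrics can shrink towards degenerate ones at finite cost because of the factor sqrt(det G).
  So a short path may stray far, and the estimate must not depend on where the path runs. Hence
  functions with a differential bound valid on all positive definite matrices. The differential of
  log(1 + v . G v) is bounded by the norm of h relative to G, but lacks the factor det^(1/4) that
  matches the density; multiplying by det^(1/4) supplies it, and det^(1/4) has logarithmic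
  differential tr(G^-1 h)/4, which is of the same order. Dividing by 1 + v . G v, rather than
  multiplying by its logarithm, keeps the product below det^(1/4). The constant n + 2 is a rounded
  value coming from (x - y)^2 \<le> 2 x^2 + 2 y^2. The norm of F_v(g_t) - F_v(g_0) is not
  differentiated along the path. The difference at the end points is frozen as a weight w, and the
  linear functional "integral of w F_v" is followed, so that calculus in one real variable
  applies.\<close>

definition spd :: "real ^ 'n ^ 'n::finite \<Rightarrow> bool" where
  "spd G \<longleftrightarrow> transpose G = G \<and> (\<forall>v. v \<noteq> 0 \<longrightarrow> v \<bullet> (G *v v) > 0)"

lemma symmetric_bilinear_commute:
  fixes G :: "real ^ 'n ^ 'n::finite"
  assumes "transpose G = G"
  shows "x \<bullet> (G *v y) = y \<bullet> (G *v x)"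
  by (metis assms dot_lmul_matrix inner_commute transpose_matrix_vector)

text \<open>Gram-Schmidt for the inner product given by \<open>G\<close>, as an induction over index
  sets: while an index is missing, fewer than n vectors are present, so some \<open>w\<close> lies
  outside their span.\<close>

lemma spd_orthonormal_family:
  fixes G :: "real ^ 'n ^ 'n::finite"
  assumes G: "spd G"
  shows "\<exists>e :: 'n \<Rightarrow> real ^ 'n. \<forall>i\<in>I. \<forall>j\<in>I. e i \<bullet> (G *v e j) = (if i = j then 1 else 0)"
  using finite[of I]
proof (induction I rule: finite_induct)
  case empty
  then show ?case by simp
next
  case (insert k I)
  have sym: "x \<bullet> (G *v y) = y \<bullet> (G *v x)" for x y
    using G by (intro symmetric_bilinear_commute) (simp add: spd_def)
  obtain e where e: "\<And>i j. i \<in> I \<Longrightarrow> j \<in> I \<Longrightarrow> e i \<bullet> (G *v e j) = (if i = j then 1 else 0)"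
    using insert.IH by blast
  have "card I < CARD('n)"
    using insert.hyps by (metis UNIV_I finite_code card_mono card_seteq linorder_not_le subset_UNIV)
  then have "dim (e ` I) < DIM(real ^ 'n)"
    using dim_le_card[OF span_superset[of "e ` I"]] card_image_le[of I e] by (auto simp: insert.hyps)
  then obtain w where w: "w \<notin> span (e ` I)"
    by (metis UNIV_eq_I dim_UNIV dim_span less_irrefl)
  \<comment> \<open>This is \<open>w\<close> minus its \<open>G\<close>-orthogonal projection to the
    span; dividing by its \<open>G\<close>-length gives the new member.\<close>
  define u where "u = w - (\<Sum>i\<in>I. (e i \<bullet> (G *v w)) *\<^sub>R e i)"
  have "u \<noteq> 0"
  proof
    assume "u = 0"
    then have "w = (\<Sum>i\<in>I. (e i \<bullet> (G *v w)) *\<^sub>R e i)" by (simp add: u_def)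
    also have "\<dots> \<in> span (e ` I)" by (intro span_sum span_scale span_base) auto
    finally show False using w by simp
  qed
  then have upos: "u \<bullet> (G *v u) > 0" using G by (simp add: spd_def)
  have ortho: "u \<bullet> (G *v e j) = 0" if "j \<in> I" for j
  proof -
    have "(\<Sum>i\<in>I. (e i \<bullet> (G *v w)) * (e i \<bullet> (G *v e j))) = (\<Sum>i\<in>I. if i = j then e i \<bullet> (G *v w) else 0)"
      using that by (intro sum.cong) (auto simp: e)
    then show ?thesis
      using that insert.hyps sym[of w "e j"] by (simp add: u_def inner_diff_left inner_sum_left)
  qed
  define e' where "e' = e(k := u /\<^sub>R sqrt (u \<bullet> (G *v u)))"
  have "e' i \<bullet> (G *v e' j) = (if i = j then 1 else 0)" if "i \<in> insert k I" "j \<in> insert k I" for i j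
  proof -
    have "e i \<bullet> (G *v u) = 0" if "i \<in> I" for i using ortho[OF that] sym[of u] by simp
    moreover have "inverse (sqrt (u \<bullet> (G *v u))) * (inverse (sqrt (u \<bullet> (G *v u))) * (u \<bullet> (G *v u))) = 1"
      using upos by (simp add: field_simps)
    ultimately show ?thesis
      using that insert.hyps ortho e upos
      by (auto simp: e'_def matrix_vector_mult_scaleR)
  qed
  then show ?case by blast
qed

text \<open>The rows of \<open>R\<close> form a \<open>G\<close>-orthonormal basis. The
  factorisation plays the part of a square root of \<open>G\<close>: the determinant and trace
  inequalities below are read off in this basis.\<close>

lemma spd_congruent_identity:
  fixes G :: "real ^ 'n ^ 'n::finite"
  assumes G: "spd G"
  obtains R :: "real ^ 'n ^ 'n" where "R ** G ** transpose R = mat 1"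
proof -
  obtain e :: "'n \<Rightarrow> real ^ 'n" where e: "\<And>i j. e i \<bullet> (G *v e j) = (if i = j then 1 else 0)"
    using spd_orthonormal_family[OF G, of UNIV] by auto
  define R :: "real ^ 'n ^ 'n" where "R = (\<chi> i. e i)"
  have "(R ** G ** transpose R) $ i $ j = e i \<bullet> (G *v e j)" for i j
  proof -
    have "R ** G ** transpose R = R ** (G ** transpose R)" by (simp add: matrix_mul_assoc)
    also have "\<dots> $ i $ j = (\<Sum>k\<in>UNIV. e i $ k * (\<Sum>l\<in>UNIV. G $ k $ l * e j $ l))"
      by (simp add: matrix_matrix_mult_def R_def transpose_def)
    finally show ?thesis by (simp add: inner_vec_def matrix_vector_mult_def)
  qed
  then have "R ** G ** transpose R = mat 1"
    by (simp add: vec_eq_iff e mat_def)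
  then show thesis by (rule that)
qed

lemma matrix_inv:
  fixes G :: "real ^ 'n ^ 'n::finite"
  assumes "invertible G"
  shows matrix_inv_left: "matrix_inv G ** G = mat 1" and matrix_inv_right: "G ** matrix_inv G = mat 1"
proof -
  have "G ** matrix_inv G = mat 1 \<and> matrix_inv G ** G = mat 1"
    using assms unfolding invertible_def matrix_inv_def by (rule someI_ex)
  then show "matrix_inv G ** G = mat 1" "G ** matrix_inv G = mat 1" by auto
qed

lemma matrix_inv_eqI:
  fixes G :: "real ^ 'n ^ 'n::finite"
  assumes "G ** X = mat 1"
  shows "matrix_inv G = X"
proof -
  have "invertible G" using assms invertible_right_inverse by blast
  then have "matrix_inv G ** G = mat 1" by (rule matrix_inv_left)
  then show ?thesis
    by (metis assms matrix_mul_assoc matrix_mul_lid matrix_mul_rid)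
qed

text \<open>From R (G R^T) = 1 follows (G R^T) R = 1, as one-sided inverses of square matrices are
  two-sided.\<close>

lemma spd_inverse_factor:
  fixes R G :: "real ^ 'n ^ 'n::finite"
  assumes "R ** G ** transpose R = mat 1"
  shows "matrix_inv G = transpose R ** R"
proof (rule matrix_inv_eqI)
  have "R ** (G ** transpose R) = mat 1" using assms by (simp add: matrix_mul_assoc)
  then have "(G ** transpose R) ** R = mat 1" by (simp add: matrix_left_right_inverse)
  then show "G ** (transpose R ** R) = mat 1" by (simp add: matrix_mul_assoc)
qed

text \<open>Taking determinants in R G R^T = 1 gives (det R)^2 det G = 1.\<close>

lemma spd_det_pos:
  fixes G :: "real ^ 'n ^ 'n::finite"
  assumes "spd G"
  shows "det G > 0"
proof -
  obtain R :: "real ^ 'n ^ 'n" where "R ** G ** transpose R = mat 1" using spd_congruent_identity[OF assms] .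
  then have "det R * det G * det R = 1" by (metis det_I det_mul det_transpose)
  then have "(det R)\<^sup>2 * det G = 1" by (simp add: power2_eq_square ac_simps)
  then show ?thesis by (metis zero_less_mult_pos zero_less_one zero_less_power2 mult_zero_left power_zero_numeral)
qed

text \<open>In a basis that is orthonormal for \<open>G\<close> the form \<open>\<langle>h, h\<rangle>\<^sub>G\<close> is the squared Frobenius norm of \<open>h\<close>.\<close>

lemma spd_trace_factor:
  fixes R G h :: "real ^ 'n ^ 'n::finite"
  assumes R: "R ** G ** transpose R = mat 1" and h: "transpose h = h"
  defines "k \<equiv> R ** h ** transpose R"
  shows "trace (matrix_inv G ** h ** matrix_inv G ** h) = (\<Sum>i\<in>UNIV. \<Sum>j\<in>UNIV. (k $ i $ j)\<^sup>2)"
    and "trace (matrix_inv G ** h) = trace k"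
proof -
  note inv = spd_inverse_factor[OF R]
  have "transpose k = k"
    by (simp add: k_def matrix_transpose_mul h matrix_mul_assoc transpose_transpose)
  then have kk: "k $ i $ j = k $ j $ i" for i j
  proof -
    have "transpose k $ i $ j = k $ j $ i" by (simp add: transpose_def)
    then show ?thesis using \<open>transpose k = k\<close> by simp
  qed
  \<comment> \<open>Isolating the first factor lets the cyclic property of the trace move it to the
    end, which produces \<open>k ** k\<close>.\<close>
  have "matrix_inv G ** h ** matrix_inv G ** h = transpose R ** (R ** h ** transpose R ** R ** h)"
    by (simp add: inv matrix_mul_assoc)
  then have "trace (matrix_inv G ** h ** matrix_inv G ** h) = trace (R ** h ** transpose R ** R ** h ** transpose R)"
    by (simp only: trace_mul_sym[of "transpose R"])
  also have "\<dots> = trace (k ** k)"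
    by (simp add: k_def matrix_mul_assoc)
  also have "\<dots> = (\<Sum>i\<in>UNIV. \<Sum>j\<in>UNIV. k $ i $ j * k $ j $ i)"
    by (simp add: trace_def matrix_matrix_mult_def)
  also have "\<dots> = (\<Sum>i\<in>UNIV. \<Sum>j\<in>UNIV. (k $ i $ j)\<^sup>2)"
    by (simp add: power2_eq_square kk)
  finally show "trace (matrix_inv G ** h ** matrix_inv G ** h) = (\<Sum>i\<in>UNIV. \<Sum>j\<in>UNIV. (k $ i $ j)\<^sup>2)" .
  have "matrix_inv G ** h = transpose R ** (R ** h)" by (simp add: inv matrix_mul_assoc)
  then show "trace (matrix_inv G ** h) = trace k"
    by (simp add: trace_mul_sym[of "transpose R"] k_def)
qed

lemma spd_trace_nonneg:
  fixes G h :: "real ^ 'n ^ 'n::finite"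
  assumes "spd G" "transpose h = h"
  shows "0 \<le> trace (matrix_inv G ** h ** matrix_inv G ** h)"
proof -
  obtain R :: "real ^ 'n ^ 'n" where "R ** G ** transpose R = mat 1" using spd_congruent_identity[OF assms(1)] .
  then show ?thesis by (simp add: spd_trace_factor assms sum_nonneg)
qed

text \<open>In the orthonormal basis this is Cauchy-Schwarz for the diagonal of \<open>k\<close>
  against the constant vector 1, of squared norm n; the off-diagonal squares only enlarge the right
  side.\<close>

lemma spd_trace_bound:
  fixes G h :: "real ^ 'n ^ 'n::finite"
  assumes "spd G" "transpose h = h"
  shows "(trace (matrix_inv G ** h))\<^sup>2 \<le> CARD('n) * trace (matrix_inv G ** h ** matrix_inv G ** h)"
proof -
  obtain R :: "real ^ 'n ^ 'n" where R: "R ** G ** transpose R = mat 1" using spd_congruent_identity[OF assms(1)] .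
  define k where "k = R ** h ** transpose R"
  have "(trace k)\<^sup>2 \<le> (\<Sum>i::'n\<in>UNIV. 1\<^sup>2) * (\<Sum>i\<in>UNIV. (k $ i $ i)\<^sup>2)"
    unfolding trace_def using Cauchy_Schwarz_ineq_sum[of "\<lambda>_. 1" "\<lambda>i. k $ i $ i" UNIV] by simp
  also have "\<dots> \<le> CARD('n) * (\<Sum>i\<in>UNIV. \<Sum>j\<in>UNIV. (k $ i $ j)\<^sup>2)"
    by (auto intro!: mult_left_mono sum_mono member_le_sum)
  finally show ?thesis
    by (simp add: spd_trace_factor[OF R assms(2)] k_def)
qed

text \<open>With v = R^T w the two forms become w . w and w . (k w), and the Frobenius norm of
  \<open>k\<close> dominates its operator norm.\<close>

lemma spd_quadratic_bound:
  fixes G h :: "real ^ 'n ^ 'n::finite"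
  assumes "spd G" "transpose h = h"
  shows "(v \<bullet> (h *v v))\<^sup>2 \<le> (v \<bullet> (G *v v))\<^sup>2 * trace (matrix_inv G ** h ** matrix_inv G ** h)"
proof -
  obtain R :: "real ^ 'n ^ 'n" where R: "R ** G ** transpose R = mat 1" using spd_congruent_identity[OF assms(1)] .
  define k where "k = R ** h ** transpose R"
  define Q where "Q = matrix_inv (transpose R)"
  have "invertible R"
    unfolding invertible_right_inverse using R by (auto simp: matrix_mul_assoc intro!: exI[of _ "G ** transpose R"])
  then have "invertible (transpose R)" by (simp add: invertible_det_nz)
  then have Q: "transpose R ** Q = mat 1"
    unfolding Q_def by (simp add: matrix_inv_right)
  define w where "w = Q *v v"
  have v: "v = transpose R *v w" by (simp add: w_def matrix_vector_mul_assoc Q)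
  have conj: "v \<bullet> (X *v v) = w \<bullet> ((R ** X ** transpose R) *v w)" for X
    unfolding v by (metis dot_lmul_matrix matrix_vector_mul_assoc transpose_matrix_vector)
  have "w \<bullet> (k *v w) = (\<Sum>i\<in>UNIV. w $ i * (k *v w) $ i)" by (simp add: inner_vec_def)
  then have "(w \<bullet> (k *v w))\<^sup>2 \<le> (\<Sum>i\<in>UNIV. (w $ i)\<^sup>2) * (\<Sum>i\<in>UNIV. ((k *v w) $ i)\<^sup>2)"
    by (simp add: Cauchy_Schwarz_ineq_sum)
  also have "\<dots> \<le> (\<Sum>i\<in>UNIV. (w $ i)\<^sup>2) * (\<Sum>i\<in>UNIV. (\<Sum>j\<in>UNIV. (k $ i $ j)\<^sup>2) * (\<Sum>j\<in>UNIV. (w $ j)\<^sup>2))"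
    by (intro mult_left_mono sum_mono)
       (auto simp: matrix_vector_mult_def Cauchy_Schwarz_ineq_sum intro!: sum_nonneg)
  also have "\<dots> = (w \<bullet> w)\<^sup>2 * (\<Sum>i\<in>UNIV. \<Sum>j\<in>UNIV. (k $ i $ j)\<^sup>2)"
    by (simp add: inner_vec_def power2_eq_square sum_distrib_right[symmetric])
  finally have "(w \<bullet> (k *v w))\<^sup>2 \<le> (w \<bullet> w)\<^sup>2 * (\<Sum>i\<in>UNIV. \<Sum>j\<in>UNIV. (k $ i $ j)\<^sup>2)" .
  then show ?thesis
    by (simp add: conj R spd_trace_factor[OF R assms(2)] k_def)
qed

text \<open>Makes the segment between two metrics an admissible path, so that the distance is the
  infimum of a nonempty set.\<close>

lemma spd_convex:
  assumes "spd G" "spd H" "0 \<le> s" "s \<le> (1::real)"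
  shows "spd ((1 - s) *\<^sub>R G + s *\<^sub>R H)"
  unfolding spd_def
proof (intro conjI allI impI)
  show "transpose ((1 - s) *\<^sub>R G + s *\<^sub>R H) = (1 - s) *\<^sub>R G + s *\<^sub>R H"
    using assms by (simp add: spd_def transpose_def vec_eq_iff)
  fix v :: "real ^ 'a" assume v: "v \<noteq> 0"
  let ?a = "v \<bullet> (G *v v)" and ?b = "v \<bullet> (H *v v)"
  have ab: "?a > 0" "?b > 0" using assms v by (auto simp: spd_def)
  have "(1 - s) * ?a + s * ?b > 0"
    using ab assms(3,4) by (cases "s = 0") (auto intro: add_nonneg_pos)
  then show "v \<bullet> (((1 - s) *\<^sub>R G + s *\<^sub>R H) *v v) > 0"
    by (simp add: matrix_vector_mult_add_rdistrib scaleR_matrix_vector_assoc[symmetric] inner_add_right)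
qed

text \<open>Polarisation; i = j gives the vector 2 e_i and hence the diagonal. Finitely many test
  vectors will later mean finitely many exceptional null sets.\<close>

lemma symmetric_eq_by_quadratic_forms:
  fixes G H :: "real ^ 'n ^ 'n::finite"
  assumes sym: "transpose G = G" "transpose H = H"
    and eq: "\<And>i j. (axis i 1 + axis j 1) \<bullet> (G *v (axis i 1 + axis j 1)) = (axis i 1 + axis j 1) \<bullet> (H *v (axis i 1 + axis j 1))"
  shows "G = H"
proof -
  have ent: "axis i 1 \<bullet> (X *v axis j 1) = X $ i $ j" for i j and X :: "real ^ 'n ^ 'n"
    by (simp add: inner_axis' matrix_vector_mul_component inner_axis)
  have s: "X $ j $ i = X $ i $ j" if "transpose X = X" for i j and X :: "real ^ 'n ^ 'n"
    using arg_cong[OF that, of "\<lambda>M. M $ i $ j"] by (simp add: transpose_def)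
  have q: "(axis i 1 + axis j 1) \<bullet> (X *v (axis i 1 + axis j 1)) = X $ i $ i + X $ i $ j + X $ j $ i + X $ j $ j"
    for i j and X :: "real ^ 'n ^ 'n"
    by (simp only: matrix_vector_right_distrib inner_add_left inner_add_right ent)
  have d: "G $ i $ i = H $ i $ i" for i using eq[of i i] unfolding q by simp
  have "G $ i $ j = H $ i $ j" for i j
    using eq[of i j] d unfolding q s[OF sym(1), of i j] s[OF sym(2), of i j] by simp
  then show ?thesis by (simp add: vec_eq_iff)
qed

text \<open>Only the identity permutation contributes, since any other one moves at least two points.\<close>

lemma has_real_derivative_det_at_identity:
  fixes X :: "real \<Rightarrow> real ^ 'n ^ 'n::finite"
  assumes d: "\<And>i j. ((\<lambda>s. X s $ i $ j) has_real_derivative D $ i $ j) (at t within I)"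
    and X: "X t = mat 1"
  shows "((\<lambda>s. det (X s)) has_real_derivative trace D) (at t within I)"
proof -
  have prod: "((\<lambda>s. \<Prod>i\<in>UNIV. X s $ i $ p i) has_real_derivative
      (\<Sum>i\<in>UNIV. D $ i $ p i * (\<Prod>j\<in>UNIV - {i}. X t $ j $ p j))) (at t within I)" for p :: "'n \<Rightarrow> 'n"
  proof -
    have "((\<lambda>s. \<Prod>i\<in>UNIV. X s $ i $ p i) has_derivative
      (\<lambda>y. \<Sum>i\<in>UNIV. D $ i $ p i * y * (\<Prod>j\<in>UNIV - {i}. X t $ j $ p j))) (at t within I)"
      using d by (intro has_derivative_prod) (simp add: has_field_derivative_def)
    then show ?thesis
      by (rule has_derivative_imp_has_field_derivative) (simp add: sum_distrib_left sum_distrib_right mult_ac)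
  qed
  have vanish: "(\<Sum>i\<in>UNIV. D $ i $ p i * (\<Prod>j\<in>UNIV - {i}. X t $ j $ p j)) = (if p = id then trace D else 0)"
    if p: "p permutes UNIV" for p :: "'n \<Rightarrow> 'n"
  proof (cases "p = id")
    case True
    then show ?thesis by (simp add: trace_def X mat_def)
  next
    case False
    have moved: "\<exists>j. j \<noteq> i \<and> p j \<noteq> j" for i
    proof (rule ccontr)
      assume "\<nexists>j. j \<noteq> i \<and> p j \<noteq> j"
      then have j: "p j = j" if "j \<noteq> i" for j using that by blast
      moreover have "p i = i" using j p by (metis permutes_def)
      ultimately have "p = id" by (metis eq_id_iff)
      then show False using False by simp
    qed
    have ex: "\<exists>j\<in>UNIV - {i}. X t $ j $ p j = 0" for i
    proof -
      obtain j where "j \<noteq> i" "p j \<noteq> j" using moved[of i] by blast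
      then show ?thesis by (intro bexI[of _ j]) (auto simp: X mat_def)
    qed
    have z: "(\<Prod>j\<in>UNIV - {i}. X t $ j $ p j) = 0" for i
      by (rule prod_zero[OF _ ex]) simp
    show ?thesis using False by (simp only: z if_False mult_zero_right sum.neutral_const)
  qed
  have "((\<lambda>s. det (X s)) has_real_derivative
     (\<Sum>p | p permutes UNIV. of_int (sign p) * (\<Sum>i\<in>UNIV. D $ i $ p i * (\<Prod>j\<in>UNIV - {i}. X t $ j $ p j)))) (at t within I)"
    unfolding det_def by (intro DERIV_sum DERIV_cmult prod)
  also have "(\<Sum>p | p permutes UNIV. of_int (sign p) * (\<Sum>i\<in>UNIV. D $ i $ p i * (\<Prod>j\<in>UNIV - {i}. X t $ j $ p j)))
     = (\<Sum>p | p permutes (UNIV::'n set). if p = id then trace D else 0)"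
    by (intro sum.cong refl) (auto simp: vanish sign_id)
  also have "\<dots> = trace D" by (simp add: permutes_id)
  finally show ?thesis .
qed

text \<open>Jacobi's formula. Multiplying by the constant inverse of \<open>G t\<close> moves the
  base point to the identity, and multiplicativity of \<open>det\<close> removes that factor
  again.\<close>

lemma has_real_derivative_det:
  fixes G :: "real \<Rightarrow> real ^ 'n ^ 'n::finite"
  assumes d: "\<And>i j. ((\<lambda>s. G s $ i $ j) has_real_derivative H $ i $ j) (at t within I)"
    and inv: "spd (G t)"
  shows "((\<lambda>s. det (G s)) has_real_derivative det (G t) * trace (matrix_inv (G t) ** H)) (at t within I)"
proof -
  let ?Y = "matrix_inv (G t)"
  have det0: "det (G t) \<noteq> 0" using spd_det_pos[OF inv] by simp
  then have Y: "?Y ** G t = mat 1" by (simp add: invertible_det_nz matrix_inv_left)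
  have "((\<lambda>s. det (?Y ** G s)) has_real_derivative trace (?Y ** H)) (at t within I)"
  proof (rule has_real_derivative_det_at_identity)
    show "((\<lambda>s. (?Y ** G s) $ i $ j) has_real_derivative (?Y ** H) $ i $ j) (at t within I)" for i j
      unfolding matrix_matrix_mult_def by simp (intro DERIV_sum DERIV_cmult d)
  qed (rule Y)
  then have "((\<lambda>s. det (G t) * det (?Y ** G s)) has_real_derivative det (G t) * trace (?Y ** H)) (at t within I)"
    by (rule DERIV_cmult)
  moreover have "det (G t) * det (?Y ** G s) = det (G s)" for s
    using arg_cong[OF Y, of det] unfolding det_mul det_I
    by (metis mult.assoc mult.commute mult_1)
  ultimately show ?thesis by simp
qed

section \<open>The separating functions and their differential bound\<close>

definition sep_fun :: "real ^ 'n \<Rightarrow> real ^ 'n ^ 'n::finite \<Rightarrow> real" where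
  "sep_fun v G = sqrt (sqrt (det G)) / (1 + v \<bullet> (G *v v))"

text \<open>Written as the function times its logarithmic derivative, so that the volume factor and
  the two terms in \<open>H\<close> can be bounded separately.\<close>

definition sep_fun_deriv :: "real ^ 'n \<Rightarrow> real ^ 'n ^ 'n::finite \<Rightarrow> real ^ 'n ^ 'n \<Rightarrow> real" where
  "sep_fun_deriv v G H = sep_fun v G *
     (trace (matrix_inv G ** H) / 4 - v \<bullet> (H *v v) / (1 + v \<bullet> (G *v v)))"

lemma spd_quadratic_nonneg: "spd G \<Longrightarrow> 0 \<le> v \<bullet> (G *v v)"
  by (cases "v = 0") (auto simp: spd_def less_imp_le)

lemma has_real_derivative_sep_fun:
  fixes G :: "real \<Rightarrow> real ^ 'n ^ 'n::finite"
  assumes d: "\<And>i j. ((\<lambda>s. G s $ i $ j) has_real_derivative H $ i $ j) (at t within I)"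
    and spd: "spd (G t)"
  shows "((\<lambda>s. sep_fun v (G s)) has_real_derivative sep_fun_deriv v (G t) H) (at t within I)"
proof -
  have det0: "det (G t) > 0" using spd_det_pos[OF spd] .
  have nn: "0 \<le> v \<bullet> (G t *v v)" by (rule spd_quadratic_nonneg[OF spd])
  have q: "((\<lambda>s. v \<bullet> (G s *v v)) has_real_derivative v \<bullet> (H *v v)) (at t within I)"
    unfolding inner_vec_def matrix_vector_mult_def
    by simp (intro DERIV_sum DERIV_cmult DERIV_cmult_right d)
  note D = has_real_derivative_det[OF d spd]
  let ?r = "sqrt (sqrt (det (G t)))"
  have r: "?r > 0" "sqrt (det (G t)) = ?r * ?r" "det (G t) = ?r * ?r * (?r * ?r)"
    using det0 by (auto simp flip: real_sqrt_mult)
  have "((\<lambda>s. sep_fun v (G s)) has_real_derivative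
     ((inverse ?r / 2 * (inverse (sqrt (det (G t))) / 2 * (det (G t) * trace (matrix_inv (G t) ** H)))) * (1 + v \<bullet> (G t *v v))
       - ?r * (0 + v \<bullet> (H *v v))) / ((1 + v \<bullet> (G t *v v)) * (1 + v \<bullet> (G t *v v)))) (at t within I)"
    unfolding sep_fun_def
    apply (intro DERIV_divide DERIV_chain'[OF _ DERIV_real_sqrt] DERIV_add q D DERIV_const)
    using det0 nn by auto
  also have "((inverse ?r / 2 * (inverse (sqrt (det (G t))) / 2 * (det (G t) * trace (matrix_inv (G t) ** H)))) * (1 + v \<bullet> (G t *v v))
       - ?r * (0 + v \<bullet> (H *v v))) / ((1 + v \<bullet> (G t *v v)) * (1 + v \<bullet> (G t *v v))) = sep_fun_deriv v (G t) H"
  proof -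
    have "inverse r / 2 * (inverse (r * r) / 2 * (r * r * (r * r) * T)) = r * T / 4" if "r > 0" for r T :: real
      using that by (simp add: field_simps)
    from this[OF r(1), of "trace (matrix_inv (G t) ** H)"]
    have a: "inverse ?r / 2 * (inverse (sqrt (det (G t))) / 2 * (det (G t) * trace (matrix_inv (G t) ** H)))
      = ?r * trace (matrix_inv (G t) ** H) / 4"
      using r by metis
    have "1 + v \<bullet> (G t *v v) \<noteq> 0" using nn by simp
    then show ?thesis
      unfolding a sep_fun_deriv_def sep_fun_def by (simp add: field_simps)
  qed
  finally show ?thesis .
qed

text \<open>The square of \<open>sep_fun v G\<close> is at most sqrt(det G), which supplies the
  volume factor; the two logarithmic terms are controlled by \<open>spd_trace_bound\<close> and
  \<open>spd_quadratic_bound\<close>.\<close>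

lemma sep_fun_deriv_bound:
  fixes G :: "real ^ 'n ^ 'n::finite"
  assumes spd: "spd G" and h: "transpose h = h"
  shows "(sep_fun_deriv v G h)\<^sup>2 \<le>
    (CARD('n) + 2) * (trace (matrix_inv G ** h ** matrix_inv G ** h) * sqrt (det G))"
proof -
  let ?q = "trace (matrix_inv G ** h ** matrix_inv G ** h)"
  let ?u = "v \<bullet> (G *v v)"
  have u: "0 \<le> ?u" by (rule spd_quadratic_nonneg[OF spd])
  have q: "0 \<le> ?q" by (rule spd_trace_nonneg[OF assms])
  have d: "det G > 0" using spd_det_pos[OF spd] .
  have F: "(sep_fun v G)\<^sup>2 \<le> sqrt (det G)"
  proof -
    have "1 \<le> (1 + ?u)\<^sup>2" using u by (simp add: one_le_power)
    then show ?thesis using d by (simp add: sep_fun_def power_divide divide_le_eq mult_left_le)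
  qed
  have "(v \<bullet> (h *v v) / (1 + ?u))\<^sup>2 \<le> (?u\<^sup>2 * ?q) / (1 + ?u)\<^sup>2"
    unfolding power_divide by (intro divide_right_mono spd_quadratic_bound assms) simp
  also have "\<dots> \<le> ?q"
  proof -
    have "?u\<^sup>2 \<le> (1 + ?u)\<^sup>2" using u by (intro power_mono) auto
    then have "?u\<^sup>2 * ?q \<le> (1 + ?u)\<^sup>2 * ?q" using q by (intro mult_right_mono)
    then show ?thesis using u by (simp add: divide_le_eq mult.commute)
  qed
  finally have b: "(v \<bullet> (h *v v) / (1 + ?u))\<^sup>2 \<le> ?q" .
  \<comment> \<open>The trace bound gives n/16; it is rounded up to n/2, which the doubling in
    \<open>sq\<close> turns into n. The other term contributes the 2 in n + 2.\<close>
  have a: "(trace (matrix_inv G ** h) / 4)\<^sup>2 \<le> CARD('n) * ?q / 2"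
    using spd_trace_bound[OF assms] mult_nonneg_nonneg[OF of_nat_0_le_iff[of "CARD('n)"] q]
    by (simp add: power_divide)
  have sq: "(x - y)\<^sup>2 \<le> 2 * x\<^sup>2 + 2 * y\<^sup>2" for x y :: real
    using zero_le_power2[of "x + y"] by (simp add: power2_eq_square algebra_simps)
  have "(trace (matrix_inv G ** h) / 4 - v \<bullet> (h *v v) / (1 + ?u))\<^sup>2 \<le> (CARD('n) + 2) * ?q"
    using sq[of "trace (matrix_inv G ** h) / 4" "v \<bullet> (h *v v) / (1 + ?u)"] a b
    by (simp add: algebra_simps)
  then have "(sep_fun_deriv v G h)\<^sup>2 \<le> sqrt (det G) * ((CARD('n) + 2) * ?q)"
    unfolding sep_fun_deriv_def power_mult_distrib using F d by (intro mult_mono) auto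
  then show ?thesis by (simp add: mult_ac)
qed

text \<open>The vector 0 recovers the determinant, hence the common numerator; the other vectors
  then recover the quadratic forms from the denominators.\<close>

lemma sep_fun_separates:
  fixes G H :: "real ^ 'n ^ 'n::finite"
  assumes spd: "spd G" "spd H"
    and eq0: "sep_fun 0 G = sep_fun 0 H"
    and eq: "\<And>i j. sep_fun (axis i 1 + axis j 1) G = sep_fun (axis i 1 + axis j 1) H"
  shows "G = H"
proof (rule symmetric_eq_by_quadratic_forms)
  show "transpose G = G" "transpose H = H" using spd by (auto simp: spd_def)
  fix i j
  let ?v = "axis i 1 + axis j 1 :: real ^ 'n"
  have "sqrt (sqrt (det G)) = sqrt (sqrt (det H))" using eq0 by (simp add: sep_fun_def)
  moreover have "sqrt (sqrt (det G)) > 0" using spd_det_pos[OF spd(1)] by simp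
  moreover have "1 + ?v \<bullet> (X *v ?v) > 0" if "spd X" for X
    using spd_quadratic_nonneg[OF that, of ?v] by linarith
  ultimately show "?v \<bullet> (G *v ?v) = ?v \<bullet> (H *v ?v)"
    using eq[of i j] spd by (auto simp: sep_fun_def frac_eq_eq)
qed

section \<open>Continuity of matrix-valued expressions\<close>

lemma continuous_on_matrix_entries:
  fixes M :: "'z::topological_space \<Rightarrow> real ^ 'n ^ 'm"
  shows "continuous_on S M \<longleftrightarrow> (\<forall>i j. continuous_on S (\<lambda>z. M z $ i $ j))"
proof
  assume R: "\<forall>i j. continuous_on S (\<lambda>z. M z $ i $ j)"
  have "continuous_on S (\<lambda>z. \<chi> i. \<chi> j. M z $ i $ j)"
    using R by (intro continuous_on_vec_lambda) simp
  then show "continuous_on S M" by simp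
qed (auto intro: continuous_on_component)

lemma continuous_on_matrix_mult:
  fixes M N :: "'z::topological_space \<Rightarrow> real ^ 'n ^ 'n::finite"
  assumes "continuous_on S M" "continuous_on S N"
  shows "continuous_on S (\<lambda>z. M z ** N z)"
  using assms unfolding continuous_on_matrix_entries matrix_matrix_mult_def
  by (auto intro!: continuous_on_sum continuous_on_mult)

lemma continuous_on_trace:
  fixes M :: "'z::topological_space \<Rightarrow> real ^ 'n ^ 'n::finite"
  shows "continuous_on S M \<Longrightarrow> continuous_on S (\<lambda>z. trace (M z))"
  unfolding trace_def by (intro continuous_intros)

lemma continuous_on_quadratic:
  fixes M :: "'z::topological_space \<Rightarrow> real ^ 'n ^ 'n::finite"
  shows "continuous_on S M \<Longrightarrow> continuous_on S (\<lambda>z. v \<bullet> (M z *v v))"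
  unfolding continuous_on_matrix_entries inner_vec_def matrix_vector_mult_def
  by (auto intro!: continuous_on_sum continuous_on_mult)

lemma continuous_on_det_matrix:
  fixes M :: "'z::topological_space \<Rightarrow> real ^ 'n ^ 'n::finite"
  shows "continuous_on S M \<Longrightarrow> continuous_on S (\<lambda>z. det (M z))"
  unfolding continuous_on_matrix_entries det_def
  by (auto intro!: continuous_on_sum continuous_on_mult continuous_on_prod)

text \<open>Exhibits the entries of the inverse as quotients of determinants, from which continuity
  of inversion follows.\<close>

lemma matrix_inv_cramer:
  fixes G :: "real ^ 'n ^ 'n::finite"
  assumes "det G \<noteq> 0"
  shows "matrix_inv G $ k $ j = det (\<chi> p q. if q = k then axis j 1 $ p else G $ p $ q) / det G"
proof -
  have "G ** matrix_inv G = mat 1" using assms by (simp add: invertible_det_nz matrix_inv_right)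
  then have "G *v (matrix_inv G *v axis j 1) = axis j 1" by (simp add: matrix_vector_mul_assoc)
  then have "matrix_inv G *v axis j 1 = (\<chi> k. det (\<chi> p q. if q = k then axis j 1 $ p else G $ p $ q) / det G)"
    using cramer[OF assms] by blast
  moreover have "(matrix_inv G *v axis j 1) $ k = matrix_inv G $ k $ j"
    by (simp add: matrix_vector_mul_component inner_axis)
  ultimately show ?thesis by simp
qed

lemma continuous_on_matrix_inv:
  fixes M :: "'z::topological_space \<Rightarrow> real ^ 'n ^ 'n::finite"
  assumes M: "continuous_on S M" and nz: "\<And>z. z \<in> S \<Longrightarrow> det (M z) \<noteq> 0"
  shows "continuous_on S (\<lambda>z. matrix_inv (M z))"
  unfolding continuous_on_matrix_entries
proof (intro allI)
  fix k j
  have "continuous_on S (\<lambda>z. det (\<chi> p q. if q = k then axis j 1 $ p else M z $ p $ q) / det (M z))"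
  proof (intro continuous_on_divide continuous_on_det_matrix M)
    show "continuous_on S (\<lambda>z. \<chi> p q. if q = k then axis j 1 $ p else M z $ p $ q)"
      unfolding continuous_on_matrix_entries
    proof (intro allI)
      fix p q
      show "continuous_on S (\<lambda>z. (\<chi> p q. if q = k then axis j 1 $ p else M z $ p $ q) $ p $ q)"
        using M by (cases "q = k") (auto simp: continuous_on_matrix_entries)
    qed
  qed (use nz in auto)
  then show "continuous_on S (\<lambda>z. matrix_inv (M z) $ k $ j)"
    by (rule continuous_on_eq) (simp add: matrix_inv_cramer nz)
qed

lemma continuous_on_sep_fun:
  assumes M: "continuous_on S M" and spd: "\<And>z. z \<in> S \<Longrightarrow> spd (M z)"
  shows "continuous_on S (\<lambda>z. sep_fun v (M z))"
  unfolding sep_fun_def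
proof (intro continuous_on_divide continuous_on_add continuous_on_const continuous_on_real_sqrt
    continuous_on_det_matrix continuous_on_quadratic M ballI)
  show "1 + v \<bullet> (M z *v v) \<noteq> 0" if "z \<in> S" for z
    using spd_quadratic_nonneg[OF spd[OF that], of v] by linarith
qed

lemma continuous_on_sep_fun_deriv:
  assumes M: "continuous_on S M" and N: "continuous_on S N" and spd: "\<And>z. z \<in> S \<Longrightarrow> spd (M z)"
  shows "continuous_on S (\<lambda>z. sep_fun_deriv v (M z) (N z))"
  unfolding sep_fun_deriv_def
proof (intro continuous_on_mult continuous_on_diff continuous_on_divide continuous_on_add
    continuous_on_const continuous_on_sep_fun continuous_on_trace continuous_on_matrix_mult
    continuous_on_matrix_inv continuous_on_quadratic M N ballI)
  show "1 + v \<bullet> (M z *v v) \<noteq> 0" if "z \<in> S" for z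
    using spd_quadratic_nonneg[OF spd[OF that], of v] by linarith
  show "det (M z) \<noteq> 0" if "z \<in> S" for z using spd_det_pos[OF spd[OF that]] by simp
qed (use spd in auto)

section \<open>Integrals depending on a parameter\<close>

lemma set_integrable_compact_subset:
  fixes f :: "'a::euclidean_space \<Rightarrow> real"
  assumes "compact K" "continuous_on K f" "E \<in> sets borel" "E \<subseteq> K"
  shows "set_integrable lborel E f"
proof (rule set_integrable_subset)
  show "set_integrable lborel K f"
    unfolding set_integrable_def by (rule borel_integrable_compact) (use assms in auto)
qed (use assms in auto)

lemma set_integral_nonneg_lborel:
  fixes f :: "'a::euclidean_space \<Rightarrow> real"
  assumes "\<And>x. x \<in> E \<Longrightarrow> 0 \<le> f x"
  shows "0 \<le> set_lebesgue_integral lborel E f"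
  unfolding set_lebesgue_integral_def
  by (intro Bochner_Integration.integral_nonneg) (auto simp: indicator_def assms)

text \<open>The integral of (s f + g)^2 is a nonnegative polynomial in s with coefficients p, 2 q
  and r.\<close>

lemma set_integral_Cauchy_Schwarz:
  fixes f g :: "'a::euclidean_space \<Rightarrow> real"
  assumes f: "set_integrable lborel E (\<lambda>x. (f x)\<^sup>2)" and g: "set_integrable lborel E (\<lambda>x. (g x)\<^sup>2)"
    and fg: "set_integrable lborel E (\<lambda>x. f x * g x)"
  shows "\<bar>LINT x:E|lborel. f x * g x\<bar> \<le>
    sqrt (LINT x:E|lborel. (f x)\<^sup>2) * sqrt (LINT x:E|lborel. (g x)\<^sup>2)"
proof -
  define p where "p = (LINT x:E|lborel. (f x)\<^sup>2)"
  define q where "q = (LINT x:E|lborel. f x * g x)"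
  define r where "r = (LINT x:E|lborel. (g x)\<^sup>2)"
  have pr: "0 \<le> p" "0 \<le> r" unfolding p_def r_def by (intro set_integral_nonneg_lborel; simp)+
  have quad: "0 \<le> s\<^sup>2 * p + (2 * s * q + r)" for s
  proof -
    have "0 \<le> (LINT x:E|lborel. (s * f x + g x)\<^sup>2)" by (intro set_integral_nonneg_lborel) simp
    also have "\<dots> = (LINT x:E|lborel. s\<^sup>2 * (f x)\<^sup>2 + (2 * s * (f x * g x) + (g x)\<^sup>2))"
      by (simp add: power2_sum power_mult_distrib mult_ac add_ac)
    also have "\<dots> = s\<^sup>2 * p + (2 * s * q + r)"
      unfolding p_def q_def r_def using f g fg
      by (simp add: set_integral_add set_integrable_mult_right)
    finally show ?thesis .
  qed
  have "q\<^sup>2 \<le> p * r"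
  proof (cases "p = 0")
    case True
    have "q = 0"
    proof (rule ccontr)
      assume "q \<noteq> 0"
      \<comment> \<open>For p = 0 the polynomial is affine, and at this s its value would be
        -1.\<close>
      then show False using quad[of "- (r + 1) / (2 * q)"] True by (simp add: field_simps)
    qed
    then show ?thesis using True by simp
  next
    case False
    then have "0 \<le> (s\<^sup>2 * p + (2 * s * q + r)) * p" for s using quad[of s] pr by simp
    \<comment> \<open>The minimiser; the extra factor p clears the denominator and leaves p r -
      q^2.\<close>
    from this[of "- q / p"] show ?thesis using False pr
      by (simp add: field_simps power2_eq_square)
  qed
  then have "sqrt (q\<^sup>2) \<le> sqrt (p * r)" by (rule real_sqrt_le_mono)
  then show ?thesis unfolding p_def q_def r_def by (simp add: real_sqrt_mult)
qed

lemma set_integral_uniform_bound: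
  fixes f :: "'a::euclidean_space \<Rightarrow> real"
  assumes K: "compact K" "continuous_on K f" "E \<in> sets borel" "E \<subseteq> K"
    and b: "\<And>x. x \<in> K \<Longrightarrow> \<bar>f x\<bar> \<le> B"
  shows "\<bar>LINT x:E|lborel. f x\<bar> \<le> B * measure lborel E"
proof -
  have i: "set_integrable lborel E h" if "continuous_on K h" for h :: "'a \<Rightarrow> real"
    using set_integrable_compact_subset[OF K(1) that K(3,4)] .
  have "\<bar>LINT x:E|lborel. f x\<bar> \<le> (LINT x:E|lborel. \<bar>f x\<bar>)"
    unfolding set_lebesgue_integral_def
    by (rule order_trans[OF integral_abs_bound]) (simp add: abs_mult)
  also have "\<dots> \<le> (LINT x:E|lborel. B)"
    by (rule set_integral_mono) (use K b in \<open>auto intro!: i continuous_intros\<close>)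
  also have "\<dots> = B * measure lborel E"
    using emeasure_bounded_finite[OF bounded_subset[OF compact_imp_bounded[OF K(1)] K(4)]] K
    by (simp add: set_lebesgue_integral_def mult.commute)
  finally show ?thesis .
qed

text \<open>Heine-Cantor on the compact product: one \<open>d\<close> serves all x in
  \<open>K\<close>, which lets limits in t pass under the integral.\<close>

lemma uniformly_continuous_in_parameter:
  fixes f :: "real \<Rightarrow> 'a::euclidean_space \<Rightarrow> real"
  assumes f: "continuous_on ({a..b} \<times> K) (\<lambda>(t, x). f t x)" and K: "compact K" and e: "0 < e"
  obtains d where "0 < d"
    "\<And>s t x. s \<in> {a..b} \<Longrightarrow> t \<in> {a..b} \<Longrightarrow> \<bar>s - t\<bar> < d \<Longrightarrow> x \<in> K \<Longrightarrow> \<bar>f s x - f t x\<bar> < e"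
proof -
  have "uniformly_continuous_on ({a..b} \<times> K) (\<lambda>(t, x). f t x)"
    by (rule compact_uniformly_continuous[OF f]) (intro compact_Times compact_Icc K)
  then obtain d where d: "0 < d"
    "\<And>p q. p \<in> {a..b} \<times> K \<Longrightarrow> q \<in> {a..b} \<times> K \<Longrightarrow> dist p q < d \<Longrightarrow>
       dist ((\<lambda>(t, x). f t x) p) ((\<lambda>(t, x). f t x) q) < e"
    unfolding uniformly_continuous_on_def using e by metis
  have "\<bar>f s x - f t x\<bar> < e" if "s \<in> {a..b}" "t \<in> {a..b}" "\<bar>s - t\<bar> < d" "x \<in> K" for s t x
    using d(2)[of "(s, x)" "(t, x)"] that by (simp add: dist_Pair_Pair dist_real_def)
  then show thesis using that d(1) by blast
qed

lemma continuous_on_slice: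
  assumes "continuous_on (S \<times> K) (\<lambda>(t, x). f t x)" "t \<in> S"
  shows "continuous_on K (f t)"
proof -
  have "continuous_on K ((\<lambda>(t, x). f t x) \<circ> (\<lambda>x. (t, x)))"
    by (intro continuous_on_compose continuous_intros continuous_on_subset[OF assms(1)])
       (use assms in auto)
  then show ?thesis by (simp add: o_def)
qed

lemma continuous_on_set_integral_parameter:
  fixes f :: "real \<Rightarrow> 'a::euclidean_space \<Rightarrow> real"
  assumes f: "continuous_on ({a..b} \<times> K) (\<lambda>(t, x). f t x)"
    and K: "compact K" "E \<in> sets borel" "E \<subseteq> K"
  shows "continuous_on {a..b} (\<lambda>t. LINT x:E|lborel. f t x)"
  unfolding continuous_on_iff
proof (intro ballI allI impI)
  fix t e :: real assume t: "t \<in> {a..b}" and e: "0 < e"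
  \<comment> \<open>The added 1 keeps the divisor positive when \<open>E\<close> is a null
    set.\<close>
  define m where "m = measure lborel E + 1"
  have m: "0 < m" by (simp add: m_def add_nonneg_pos)
  obtain d where d: "0 < d"
    "\<And>s t x. s \<in> {a..b} \<Longrightarrow> t \<in> {a..b} \<Longrightarrow> \<bar>s - t\<bar> < d \<Longrightarrow> x \<in> K \<Longrightarrow> \<bar>f s x - f t x\<bar> < e / m"
    using uniformly_continuous_in_parameter[OF f K(1)] e m by (metis divide_pos_pos)
  have "\<bar>(LINT x:E|lborel. f s x) - (LINT x:E|lborel. f t x)\<bar> < e" if s: "s \<in> {a..b}" "\<bar>s - t\<bar> < d" for s
  proof -
    have c: "continuous_on K (f s)" "continuous_on K (f t)"
      using continuous_on_slice[OF f] s t by auto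
    have "(LINT x:E|lborel. f s x) - (LINT x:E|lborel. f t x) = (LINT x:E|lborel. f s x - f t x)"
      by (intro set_integral_diff(2)[symmetric] set_integrable_compact_subset[OF K(1) _ K(2,3)] c)
    also have "\<bar>\<dots>\<bar> \<le> e / m * measure lborel E"
      using d(2)[OF s(1) t s(2)]
      by (intro set_integral_uniform_bound[OF K(1) _ K(2,3)] continuous_intros c) (simp add: less_imp_le)
    also have "\<dots> < e / m * m" using e m by (intro mult_strict_left_mono) (auto simp: m_def)
    finally show ?thesis using m by simp
  qed
  then show "\<exists>d>0. \<forall>s\<in>{a..b}. dist s t < d \<longrightarrow>
      dist (LINT x:E|lborel. f s x) (LINT x:E|lborel. f t x) < e"
    using d(1) by (auto simp: dist_real_def)
qed

text \<open>The linearisation error in t is small uniformly on \<open>K\<close>, by the mean value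
  inequality and uniform continuity of \<open>f'\<close>, so it stays small after integration over
  \<open>E\<close>. Derivatives within the interval cover its end points.\<close>

lemma has_real_derivative_set_integral:
  fixes f f' :: "real \<Rightarrow> 'a::euclidean_space \<Rightarrow> real"
  assumes f: "\<And>t. t \<in> {a..b} \<Longrightarrow> continuous_on K (f t)"
    and f': "continuous_on ({a..b} \<times> K) (\<lambda>(t, x). f' t x)"
    and d: "\<And>t x. t \<in> {a..b} \<Longrightarrow> x \<in> K \<Longrightarrow> ((\<lambda>s. f s x) has_real_derivative f' t x) (at t within {a..b})"
    and K: "compact K" "E \<in> sets borel" "E \<subseteq> K"
    and t: "t \<in> {a..b}"
  shows "((\<lambda>s. LINT x:E|lborel. f s x) has_real_derivative (LINT x:E|lborel. f' t x)) (at t within {a..b})"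
  unfolding has_field_derivative_def has_derivative_within_alt
proof (intro conjI allI impI)
  show "bounded_linear ((*) (LINT x:E|lborel. f' t x))" by (rule bounded_linear_mult_right)
  fix e :: real assume e: "0 < e"
  define m where "m = measure lborel E + 1"
  have m: "0 < m" by (simp add: m_def add_nonneg_pos)
  obtain \<delta> where \<delta>: "0 < \<delta>"
    "\<And>s t x. s \<in> {a..b} \<Longrightarrow> t \<in> {a..b} \<Longrightarrow> \<bar>s - t\<bar> < \<delta> \<Longrightarrow> x \<in> K \<Longrightarrow> \<bar>f' s x - f' t x\<bar> < e / m"
    using uniformly_continuous_in_parameter[OF f' K(1)] e m by (metis divide_pos_pos)
  have "\<bar>(LINT x:E|lborel. f s x) - (LINT x:E|lborel. f t x) - (LINT x:E|lborel. f' t x) * (s - t)\<bar> \<le> e * \<bar>s - t\<bar>"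
    if s: "s \<in> {a..b}" "\<bar>s - t\<bar> < \<delta>" for s
  proof -
    have c: "continuous_on K (f s)" "continuous_on K (f t)" "continuous_on K (f' t)"
      using f s t continuous_on_slice[OF f'] by auto
    note i = set_integrable_compact_subset[OF K(1) _ K(2,3)]
    have pw: "\<bar>f s x - f t x - f' t x * (s - t)\<bar> \<le> \<bar>s - t\<bar> * (e / m)" if x: "x \<in> K" for x
    proof -
      have seg: "closed_segment t s \<subseteq> {a..b}"
        using s t by (auto simp: closed_segment_eq_real_ivl split: if_splits)
      have "norm (f s x - f t x - (s - t) *\<^sub>R f' t x) \<le> norm (s - t) * (e / m)"
      \<comment> \<open>Comparison with the linear map of slope \<open>f' t x\<close> on the segment
        from t to s, along which \<open>f'\<close> changes by at most e / m.\<close>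
      proof (rule vector_differentiable_bound_linearization[where S = "closed_segment t s" and ?x0.0 = t
            and f = "\<lambda>s. f s x" and f' = "\<lambda>r. f' r x"])
        show "((\<lambda>s. f s x) has_vector_derivative f' r x) (at r within closed_segment t s)"
          if "r \<in> closed_segment t s" for r
          using d[of r x] that seg x
          by (intro has_vector_derivative_within_subset[OF _ seg])
             (auto simp: has_real_derivative_iff_has_vector_derivative)
        show "norm (f' r x - f' t x) \<le> e / m" if "r \<in> closed_segment t s" for r
        proof -
          have "\<bar>r - t\<bar> < \<delta>" using that s by (auto simp: closed_segment_eq_real_ivl split: if_splits)
          then show ?thesis using \<delta>(2)[of r t x] that seg t x by (auto intro: less_imp_le)
        qed
      qed auto
      then show ?thesis by (simp add: mult.commute)
    qed
    have "(LINT x:E|lborel. f s x) - (LINT x:E|lborel. f t x) - (LINT x:E|lborel. f' t x) * (s - t)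
       = (LINT x:E|lborel. f s x - f t x - f' t x * (s - t))"
      using c by (simp add: i set_integral_diff set_integrable_mult_left)
    also have "\<bar>\<dots>\<bar> \<le> \<bar>s - t\<bar> * (e / m) * measure lborel E"
      by (intro set_integral_uniform_bound[OF K(1) _ K(2,3)] continuous_intros c pw)
    also have "\<dots> \<le> \<bar>s - t\<bar> * (e / m) * m" using e m by (intro mult_left_mono) (auto simp: m_def)
    finally show ?thesis using m by (simp add: mult.commute)
  qed
  then show "\<exists>d>0. \<forall>s\<in>{a..b}. norm (s - t) < d \<longrightarrow>
      norm ((LINT x:E|lborel. f s x) - (LINT x:E|lborel. f t x) - (LINT x:E|lborel. f' t x) * (s - t)) \<le> e * norm (s - t)"
    using \<delta>(1) by auto
qed

section \<open>Adding up estimates over the intervals of a subdivision\<close>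

definition subdivision :: "real set \<Rightarrow> bool" where
  "subdivision T \<longleftrightarrow> finite T \<and> {0, 1} \<subseteq> T \<and> T \<subseteq> {0..1}"

definition consecutive :: "real set \<Rightarrow> real \<Rightarrow> real \<Rightarrow> bool" where
  "consecutive T a b \<longleftrightarrow> a \<in> T \<and> b \<in> T \<and> a < b \<and> {a<..<b} \<inter> T = {}"

text \<open>Induction on the number of break points to the left of t. Used twice: with \<Phi> zero
  for integrability and sign of the speed, and with \<Phi> a weighted integral for the estimate
  along a path.\<close>

lemma integral_bound_subdivision:
  fixes N \<Phi> :: "real \<Rightarrow> real"
  assumes "subdivision T"
    and piece: "\<And>a b. consecutive T a b \<Longrightarrow>
       N integrable_on {a..b} \<and> \<Phi> b - \<Phi> a \<le> integral {a..b} N"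
  shows "N integrable_on {0..1}" "\<Phi> 1 - \<Phi> 0 \<le> integral {0..1} N"
proof -
  have T: "finite T" "{0, 1} \<subseteq> T" "T \<subseteq> {0..1}" using assms(1) by (auto simp: subdivision_def)
  have "N integrable_on {0..t} \<and> \<Phi> t - \<Phi> 0 \<le> integral {0..t} N" if "t \<in> T" for t
    using that
  proof (induction "card {s \<in> T. s < t}" arbitrary: t rule: less_induct)
    case less
    show ?case
    proof (cases "t = 0")
      case True
      then show ?thesis using integrable_on_refl[of N 0] by simp
    next
      case False
      let ?A = "{s \<in> T. s < t}"
      have A: "finite ?A" "0 \<in> ?A" using T less.prems False by auto
      \<comment> \<open>The break point just before t, so that a and t are consecutive.\<close>
      define a where "a = Max ?A"
      have "a \<in> ?A" unfolding a_def using A by (intro Max_in) auto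
      then have a: "a \<in> T" "a < t" "0 \<le> a" using T by auto
      have gap: "{a<..<t} \<inter> T = {}"
        using Max_ge[OF A(1)] unfolding a_def by fastforce
      have "{s \<in> T. s < a} \<subset> ?A" using a by auto
      then have "card {s \<in> T. s < a} < card ?A" using A(1) by (rule psubset_card_mono[rotated])
      then have IH: "N integrable_on {0..a}" "\<Phi> a - \<Phi> 0 \<le> integral {0..a} N"
        using less.hyps a(1) by auto
      have P: "N integrable_on {a..t}" "\<Phi> t - \<Phi> a \<le> integral {a..t} N"
        using piece[of a t] a(1,2) less.prems gap by (auto simp: consecutive_def)
      have "N integrable_on {0..t}"
        using Henstock_Kurzweil_Integration.integrable_combine[OF _ _ IH(1) P(1)] a by auto
      moreover have "integral {0..t} N = integral {0..a} N + integral {a..t} N"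
        using Henstock_Kurzweil_Integration.integral_combine[OF _ _ calculation, of a] a by auto
      ultimately show ?thesis using IH(2) P(2) by simp
    qed
  qed
  from this[of 1] show "N integrable_on {0..1}" "\<Phi> 1 - \<Phi> 0 \<le> integral {0..1} N" using T by auto
qed

section \<open>Smooth fields and their topology\<close>

lemma Ck_on_Suc_has_derivative:
  assumes "Ck_on (Suc k) S f" "x \<in> S"
  shows "(f has_derivative frechet_derivative f (at x)) (at x)"
  using assms by (simp add: frechet_derivative_works[symmetric])

text \<open>Derivatives are two-sided, so openness of \<open>S\<close> is used to make f and g agree
  near each point. The inductions below use this to replace a derivative by its computed
  formula.\<close>

lemma Ck_on_cong:
  assumes "open S" "\<And>x. x \<in> S \<Longrightarrow> f x = g x" "Ck_on k S f"
  shows "Ck_on k S g"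
  using assms(2,3)
proof (induction k arbitrary: f g)
  case 0
  then show ?case using continuous_on_cong[of S S f g] by simp
next
  case (Suc k)
  have d: "(g has_derivative frechet_derivative f (at x)) (at x)" if "x \<in> S" for x
  proof (rule has_derivative_transform_within_open[OF _ assms(1) that])
    show "(f has_derivative frechet_derivative f (at x)) (at x)"
      by (rule Ck_on_Suc_has_derivative[OF Suc.prems(2) that])
  qed (use Suc.prems(1) in auto)
  have "Ck_on k S (\<lambda>x. frechet_derivative g (at x) v)" for v
    by (rule Suc.IH[of "\<lambda>x. frechet_derivative f (at x) v"])
      (use Suc.prems(2) in \<open>auto simp: frechet_derivative_at[OF d]\<close>)
  then show ?case using d by (auto simp: differentiable_def)
qed

lemma Ck_on_add:
  assumes "open S" "Ck_on k S f" "Ck_on k S g"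
  shows "Ck_on k S (\<lambda>x. f x + g x)"
  using assms(2,3)
proof (induction k arbitrary: f g)
  case 0
  then show ?case by (simp add: continuous_on_add)
next
  case (Suc k)
  have d: "((\<lambda>x. f x + g x) has_derivative
      (\<lambda>v. frechet_derivative f (at x) v + frechet_derivative g (at x) v)) (at x)" if "x \<in> S" for x
    by (intro has_derivative_add Ck_on_Suc_has_derivative[OF Suc.prems(1) that]
        Ck_on_Suc_has_derivative[OF Suc.prems(2) that])
  have "Ck_on k S (\<lambda>x. frechet_derivative (\<lambda>x. f x + g x) (at x) v)" for v
    by (rule Ck_on_cong[OF assms(1) _ Suc.IH[of "\<lambda>x. frechet_derivative f (at x) v"
          "\<lambda>x. frechet_derivative g (at x) v"]])
       (use Suc.prems in \<open>auto simp: frechet_derivative_at[OF d, symmetric]\<close>)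
  then show ?case using d by (auto simp: differentiable_def)
qed

lemma Ck_on_bounded_linear:
  assumes "open S" "bounded_linear L" "Ck_on k S f"
  shows "Ck_on k S (\<lambda>x. L (f x))"
  using assms(3)
proof (induction k arbitrary: f)
  case 0
  then show ?case using assms(2) by (simp add: bounded_linear.continuous_on)
next
  case (Suc k)
  have d: "((\<lambda>x. L (f x)) has_derivative (\<lambda>v. L (frechet_derivative f (at x) v))) (at x)"
    if "x \<in> S" for x
    by (rule bounded_linear.has_derivative[OF assms(2) Ck_on_Suc_has_derivative[OF Suc.prems that]])
  have "Ck_on k S (\<lambda>x. frechet_derivative (\<lambda>x. L (f x)) (at x) v)" for v
    by (rule Ck_on_cong[OF assms(1) _ Suc.IH[of "\<lambda>x. frechet_derivative f (at x) v"]])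
       (use Suc.prems in \<open>auto simp: frechet_derivative_at[OF d, symmetric]\<close>)
  then show ?case using d by (auto simp: differentiable_def)
qed

lemma smooth_on_add: "open S \<Longrightarrow> smooth_on S f \<Longrightarrow> smooth_on S g \<Longrightarrow> smooth_on S (\<lambda>x. f x + g x)"
  by (simp add: smooth_on_def Ck_on_add)

lemma smooth_on_bounded_linear:
  "open S \<Longrightarrow> bounded_linear L \<Longrightarrow> smooth_on S f \<Longrightarrow> smooth_on S (\<lambda>x. L (f x))"
  by (simp add: smooth_on_def Ck_on_bounded_linear)

lemma smooth_on_imp_continuous_on: "smooth_on S f \<Longrightarrow> continuous_on S f"
  by (metis Ck_on.simps(1) smooth_on_def)

lemma smooth_on_imp_differentiable: "smooth_on S f \<Longrightarrow> x \<in> S \<Longrightarrow> f differentiable (at x)"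
  by (metis Ck_on.simps(2) smooth_on_def)

lemma smooth_on_iter_partial:
  assumes "smooth_on S f"
  shows "smooth_on S (iter_partial is f)"
proof (induction "is")
  case Nil
  then show ?case using assms by simp
next
  case (Cons i "is")
  then have "Ck_on (Suc k) S (iter_partial is f)" for k unfolding smooth_on_def by blast
  then show ?case unfolding smooth_on_def by simp
qed

text \<open>The induction hypothesis is an identity on \<open>S\<close> alone; openness lets it be
  differentiated there.\<close>

lemma iter_partial_scale:
  fixes f :: "real ^ 'n::finite \<Rightarrow> real"
  assumes "open S" "smooth_on S f" "x \<in> S"
  shows "iter_partial is (\<lambda>y. r * f y) x = r * iter_partial is f x"
  using assms(3)
proof (induction "is" arbitrary: x)
  case Nil
  then show ?case by simp
next
  case (Cons i "is")
  have "(iter_partial is f has_derivative frechet_derivative (iter_partial is f) (at x)) (at x)"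
    using smooth_on_imp_differentiable[OF smooth_on_iter_partial[OF assms(2)] Cons.prems]
    by (simp add: frechet_derivative_works)
  then have "((\<lambda>y. r * iter_partial is f y) has_derivative
      (\<lambda>v. r * frechet_derivative (iter_partial is f) (at x) v)) (at x)"
    by (rule has_derivative_mult_right)
  then have "(iter_partial is (\<lambda>y. r * f y) has_derivative
      (\<lambda>v. r * frechet_derivative (iter_partial is f) (at x) v)) (at x)"
    by (rule has_derivative_transform_within_open[OF _ assms(1) Cons.prems]) (simp add: Cons.IH)
  from frechet_derivative_at[OF this] show ?case by (metis iter_partial.simps(2))
qed

lemma matrix_congruence_linear:
  fixes P Q H K :: "real ^ 'n ^ 'n::finite"
  shows "P ** (a *\<^sub>R H + b *\<^sub>R K) ** Q = a *\<^sub>R (P ** H ** Q) + b *\<^sub>R (P ** K ** Q)"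
  by (simp add: vec_eq_iff matrix_matrix_mult_def sum.distrib sum_distrib_left algebra_simps)

lemma riem_metrics_spd:
  "g \<in> riem_metrics A \<Longrightarrow> c \<in> A \<Longrightarrow> x \<in> coord_image c \<Longrightarrow> spd (g c x)"
  by (auto simp: riem_metrics_def sym_tensor_fields_def spd_def)

lemma riem_metrics_sym: "g \<in> riem_metrics A \<Longrightarrow> g \<in> sym_tensor_fields A"
  by (simp add: riem_metrics_def)

lemma sym_tensor_fields_continuous:
  "h \<in> sym_tensor_fields A \<Longrightarrow> c \<in> A \<Longrightarrow> continuous_on (coord_image c) (h c)"
  by (simp add: sym_tensor_fields_def smooth_on_imp_continuous_on)

lemma sym_tensor_fields_transpose:
  "h \<in> sym_tensor_fields A \<Longrightarrow> c \<in> A \<Longrightarrow> x \<in> coord_image c \<Longrightarrow> transpose (h c x) = h c x"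
  by (simp add: sym_tensor_fields_def)

lemma sym_tensor_fields_zero:
  "h \<in> sym_tensor_fields A \<Longrightarrow> c \<notin> A \<or> x \<notin> coord_image c \<Longrightarrow> h c x = 0"
  unfolding sym_tensor_fields_def by blast

lemma sym_tensor_fields_smooth:
  "h \<in> sym_tensor_fields A \<Longrightarrow> c \<in> A \<Longrightarrow> smooth_on (coord_image c) (h c)"
  unfolding sym_tensor_fields_def by blast

lemma sym_tensor_fields_transform:
  assumes "h \<in> sym_tensor_fields A" "c \<in> A" "c' \<in> A" "x \<in> overlap c c'"
  shows "h c x = transpose (transition_jac c c' x) ** h c' (transition c c' x) ** transition_jac c c' x"
  using assms unfolding sym_tensor_fields_def by blast

locale closed_manifold =
  fixes A :: "('a::t2_space, 'n::finite) chart set"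
  assumes compact_manifold: "compact (UNIV :: 'a set)"
    and atlas: "oriented_smooth_atlas A"
begin

lemma atlas_cover: "\<exists>c\<in>A. p \<in> fst c"
  using atlas unfolding oriented_smooth_atlas_def by blast

lemma atlas_nonempty: "A \<noteq> {}"
  using atlas_cover by blast

lemma open_coord_image: "c \<in> A \<Longrightarrow> open (coord_image c)"
  and open_domain: "c \<in> A \<Longrightarrow> open (fst c)"
  and chart_homeomorphism:
    "c \<in> A \<Longrightarrow> homeomorphism (fst c) (coord_image c) (snd c) (inv_into (fst c) (snd c))"
  using atlas unfolding oriented_smooth_atlas_def by blast+

lemma smooth_transition: "c \<in> A \<Longrightarrow> c' \<in> A \<Longrightarrow> smooth_on (overlap c c') (transition c c')"
  using atlas unfolding oriented_smooth_atlas_def by blast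

lemma inv_chart: "c \<in> A \<Longrightarrow> p \<in> fst c \<Longrightarrow> inv_into (fst c) (snd c) (snd c p) = p"
  using chart_homeomorphism[of c] by (auto simp: homeomorphism_def)

text \<open>Each defining condition is linear in the field; for the transformation law this is
  linearity of congruence by a fixed matrix.\<close>

lemma sym_tensor_fields_linear:
  assumes h: "h \<in> sym_tensor_fields A" and k: "k \<in> sym_tensor_fields A"
  shows "(\<lambda>c x. a *\<^sub>R h c x + b *\<^sub>R k c x) \<in> sym_tensor_fields A"
proof -
  have 1: "smooth_on (coord_image c) (\<lambda>x. a *\<^sub>R h c x + b *\<^sub>R k c x)" if "c \<in> A" for c
    by (intro smooth_on_add smooth_on_bounded_linear[OF _ bounded_linear_scaleR_right]
        open_coord_image sym_tensor_fields_smooth[OF h] sym_tensor_fields_smooth[OF k] that)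
  have 2: "transpose (a *\<^sub>R h c x + b *\<^sub>R k c x) = a *\<^sub>R h c x + b *\<^sub>R k c x"
    if "c \<in> A" "x \<in> coord_image c" for c x
  proof -
    have "transpose (a *\<^sub>R h c x + b *\<^sub>R k c x) = a *\<^sub>R transpose (h c x) + b *\<^sub>R transpose (k c x)"
      by (simp add: vec_eq_iff transpose_def)
    then show ?thesis using sym_tensor_fields_transpose[OF h that] sym_tensor_fields_transpose[OF k that] by simp
  qed
  have 3: "a *\<^sub>R h c x + b *\<^sub>R k c x = transpose (transition_jac c c' x) **
      (a *\<^sub>R h c' (transition c c' x) + b *\<^sub>R k c' (transition c c' x)) ** transition_jac c c' x"
    if "c \<in> A" "c' \<in> A" "x \<in> overlap c c'" for c c' x
    unfolding matrix_congruence_linear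
    using sym_tensor_fields_transform[OF h that] sym_tensor_fields_transform[OF k that] by metis
  have 4: "a *\<^sub>R h c x + b *\<^sub>R k c x = 0" if "c \<notin> A \<or> x \<notin> coord_image c" for c x
    using sym_tensor_fields_zero[OF h that] sym_tensor_fields_zero[OF k that] by simp
  show ?thesis
    unfolding sym_tensor_fields_def using 1 2 3 4 by blast
qed

lemma sym_tensor_fields_scale:
  assumes "h \<in> sym_tensor_fields A"
  shows "(\<lambda>c x. a *\<^sub>R h c x) \<in> sym_tensor_fields A"
proof -
  have "(\<lambda>c x. a *\<^sub>R h c x) = (\<lambda>c x. a *\<^sub>R h c x + 0 *\<^sub>R h c x)" by simp
  then show ?thesis using sym_tensor_fields_linear[OF assms assms, of a 0] by metis
qed

lemma smooth_entry:
  assumes "h \<in> sym_tensor_fields A" "c \<in> A"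
  shows "smooth_on (coord_image c) (\<lambda>y. h c y $ i $ j)"
proof -
  have "bounded_linear (\<lambda>M :: real ^ 'n ^ 'n. M $ i $ j)"
    by (rule bounded_linear_compose[OF bounded_linear_vec_nth bounded_linear_vec_nth])
  from smooth_on_bounded_linear[OF open_coord_image[OF assms(2)] this sym_tensor_fields_smooth[OF assms]]
  show ?thesis .
qed

section \<open>The smooth topology: scaling, uniform convergence, uniqueness of limits\<close>

definition nbhd where
  "nbhd h c K is i j e = {k \<in> sym_tensor_fields A. \<forall>x\<in>K.
     \<bar>iter_partial is (\<lambda>y. k c y $ i $ j) x - iter_partial is (\<lambda>y. h c y $ i $ j) x\<bar> < e}"

lemma smooth_topology_nbhd:
  "smooth_topology A = topology_generated_by
     {nbhd h c K is i j e | h c K is i j e.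
        h \<in> sym_tensor_fields A \<and> c \<in> A \<and> compact K \<and> K \<subseteq> coord_image c \<and> e > 0}"
  unfolding smooth_topology_def nbhd_def ..

lemma openin_nbhd:
  assumes "h \<in> sym_tensor_fields A" "c \<in> A" "compact K" "K \<subseteq> coord_image c" "e > 0"
  shows "openin (smooth_topology A) (nbhd h c K is i j e)"
  unfolding smooth_topology_nbhd by (rule topology_generated_by_Basis) (use assms in blast)

lemma topspace_smooth_topology: "topspace (smooth_topology A) = sym_tensor_fields A"
proof
  show "topspace (smooth_topology A) \<subseteq> sym_tensor_fields A"
    unfolding smooth_topology_nbhd topology_generated_by_topspace by (auto simp: nbhd_def)
  show "sym_tensor_fields A \<subseteq> topspace (smooth_topology A)"
  proof
    fix h assume h: "h \<in> sym_tensor_fields A"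
    obtain c where "c \<in> A" using atlas_nonempty by blast
    \<comment> \<open>Over the empty compact set the condition is vacuous, so this subbasic set is
      the whole space, whatever the indices.\<close>
    then have "openin (smooth_topology A) (nbhd h c {} [] undefined undefined 1)"
      using h by (intro openin_nbhd) auto
    moreover have "h \<in> nbhd h c {} [] undefined undefined 1" using h by (simp add: nbhd_def)
    ultimately show "h \<in> topspace (smooth_topology A)" using openin_subset by blast
  qed
qed

text \<open>Needed for changes of parameter, which multiply velocities by a nonzero
  constant.\<close>

lemma continuous_map_scale:
  assumes r: "r \<noteq> 0"
  shows "continuous_map (smooth_topology A) (smooth_topology A) (\<lambda>h c x. r *\<^sub>R h c x)"
proof -
  let ?m = "\<lambda>(h :: ('a, 'n) field2) c x. r *\<^sub>R h c x"
  let ?B = "{nbhd h c K is i j e | h c K is i j e.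
        h \<in> sym_tensor_fields A \<and> c \<in> A \<and> compact K \<and> K \<subseteq> coord_image c \<and> e > 0}"
  \<comment> \<open>Iterated partials commute with scaling, so a subbasic set pulls back to a
    subbasic set with centre h / r and radius e / |r|.\<close>
  have pre: "?m -` nbhd h c K is i j e \<inter> sym_tensor_fields A
      = nbhd (\<lambda>c x. inverse r *\<^sub>R h c x) c K is i j (e / \<bar>r\<bar>)"
    if h: "h \<in> sym_tensor_fields A" and c: "c \<in> A" and K: "K \<subseteq> coord_image c" for h c K "is" i j e
  proof -
    have it: "iter_partial is (\<lambda>y. s * k c y $ i $ j) x = s * iter_partial is (\<lambda>y. k c y $ i $ j) x"
      if k: "k \<in> sym_tensor_fields A" and x: "x \<in> K" for k s x
      using iter_partial_scale[OF open_coord_image[OF c] smooth_entry[OF k c], of x] x K by auto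
    have eq: "\<bar>r * u - w\<bar> < e \<longleftrightarrow> \<bar>u - inverse r * w\<bar> < e / \<bar>r\<bar>" for u w
    proof -
      have "\<bar>r * u - w\<bar> = \<bar>r\<bar> * \<bar>u - inverse r * w\<bar>"
        using r by (simp add: abs_mult[symmetric] right_diff_distrib mult.assoc[symmetric])
      then show ?thesis using r by (simp add: less_divide_eq mult.commute)
    qed
    show ?thesis
      using h by (auto simp: nbhd_def it eq sym_tensor_fields_scale)
  qed
  have "continuous_map (smooth_topology A) (topology_generated_by ?B) ?m"
  proof (rule continuous_on_generated_topo)
    show "openin (smooth_topology A) (?m -` U \<inter> topspace (smooth_topology A))" if "U \<in> ?B" for U
      using that r unfolding topspace_smooth_topology
      by (auto simp: pre intro!: openin_nbhd sym_tensor_fields_scale)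
    show "?m ` topspace (smooth_topology A) \<subseteq> \<Union>?B"
      unfolding topology_generated_by_topspace[symmetric] smooth_topology_nbhd[symmetric]
        topspace_smooth_topology
      using sym_tensor_fields_scale by auto
  qed
  then show ?thesis by (simp only: smooth_topology_nbhd[symmetric])
qed

text \<open>The empty list of indices selects the seminorm of order zero. Velocities enter the
  estimates through this fact.\<close>

lemma limitin_smooth_uniform:
  assumes lim: "limitin (smooth_topology A) f l F" and c: "c \<in> A"
    and K: "compact K" "K \<subseteq> coord_image c" and e: "e > 0"
  shows "eventually (\<lambda>s. \<forall>x\<in>K. \<bar>f s c x $ i $ j - l c x $ i $ j\<bar> < e) F"
proof -
  have l: "l \<in> sym_tensor_fields A" using lim by (simp add: limitin_def topspace_smooth_topology)
  have "l \<in> nbhd l c K [] i j e" using l e by (simp add: nbhd_def)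
  with lim openin_nbhd[OF l c K e] have "eventually (\<lambda>s. f s \<in> nbhd l c K [] i j e) F"
    by (simp add: limitin_def)
  then show ?thesis by eventually_elim (simp add: nbhd_def)
qed

text \<open>One-point sets are compact, so limits are detected pointwise; outside the charts both
  fields vanish by convention. This makes \<open>velocity\<close> well defined wherever one
  exists.\<close>

lemma limitin_smooth_topology_unique:
  assumes "limitin (smooth_topology A) f l F" "limitin (smooth_topology A) f l' F" "F \<noteq> bot"
  shows "l = l'"
proof (intro ext)
  fix c x
  have sym: "l \<in> sym_tensor_fields A" "l' \<in> sym_tensor_fields A"
    using assms by (auto simp: limitin_def topspace_smooth_topology)
  show "l c x = l' c x"
  proof (cases "c \<in> A \<and> x \<in> coord_image c")
    case False
    then show ?thesis using sym_tensor_fields_zero[OF sym(1)] sym_tensor_fields_zero[OF sym(2)] by simp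
  next
    case True
    have "l c x $ i $ j = l' c x $ i $ j" for i j
    proof -
      have "((\<lambda>s. f s c x $ i $ j) \<longlongrightarrow> k c x $ i $ j) F"
        if "limitin (smooth_topology A) f k F" for k
        using limitin_smooth_uniform[OF that, of c "{x}"] True
        by (auto simp: tendsto_iff dist_real_def)
      then show ?thesis using assms tendsto_unique by blast
    qed
    then show ?thesis by (simp add: vec_eq_iff)
  qed
qed

end

section \<open>The estimate along a smooth arc\<close>

context closed_manifold
begin

text \<open>The image of a closed coordinate ball is compact, hence closed in a Hausdorff space, so
  the closure of the image of the open ball stays in the chart domain.\<close>

lemma small_neighbourhood:
  obtains c U where "c \<in> A" "open U" "p \<in> U" "closure U \<subseteq> fst c"
proof -
  obtain c where c: "c \<in> A" "p \<in> fst c" using atlas_cover by blast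
  let ?\<psi> = "inv_into (fst c) (snd c)"
  have hom: "homeomorphism (coord_image c) (fst c) ?\<psi> (snd c)"
    using chart_homeomorphism[OF c(1)] by (simp add: homeomorphism_symD)
  obtain e where e: "e > 0" "cball (snd c p) e \<subseteq> coord_image c"
    using open_contains_cball[of "coord_image c"] open_coord_image[OF c(1)] c(2)
    by (auto simp: coord_image_def)
  define U where "U = ?\<psi> ` ball (snd c p) e"
  have sub: "ball (snd c p) e \<subseteq> coord_image c" using e ball_subset_cball by blast
  have "openin (top_of_set (fst c)) U"
    unfolding U_def
    by (rule homeomorphism_imp_open_map[OF hom]) (simp add: sub open_subset)
  then have "open U" using open_domain[OF c(1)] by (metis openin_open_eq)
  moreover have "p \<in> U"
    unfolding U_def using inv_chart[OF c] e(1) by (metis centre_in_ball image_eqI)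
  moreover have "closure U \<subseteq> fst c"
  proof -
    have "continuous_on (cball (snd c p) e) ?\<psi>"
      using hom e(2) by (meson continuous_on_subset homeomorphism_cont1)
    then have "compact (?\<psi> ` cball (snd c p) e)" by (rule compact_continuous_image) simp
    then have "closed (?\<psi> ` cball (snd c p) e)" by (rule compact_imp_closed)
    then have "closure U \<subseteq> ?\<psi> ` cball (snd c p) e"
      unfolding U_def by (intro closure_minimal image_mono ball_subset_cball)
    also have "\<dots> \<subseteq> fst c" using e(2) hom by (auto simp: homeomorphism_def)
    finally show ?thesis .
  qed
  ultimately show thesis using that c(1) by blast
qed

text \<open>Gives meaning to the choice in \<open>integral_form\<close>. Compactness leaves finitely
  many small neighbourhoods, which are made disjoint one after another.\<close>

lemma chart_partition_exists: "\<exists>P. chart_partition A P"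
proof -
  have "\<exists>c U. c \<in> A \<and> open U \<and> p \<in> U \<and> closure U \<subseteq> fst c" for p
    using small_neighbourhood by metis
  then obtain c U where cU: "\<And>p. c p \<in> A" "\<And>p. open (U p)" "\<And>p. p \<in> U p" "\<And>p. closure (U p) \<subseteq> fst (c p)"
    by metis
  have "UNIV \<subseteq> (\<Union>p\<in>UNIV. U p)" using cU(3) by blast
  then obtain D where D: "D \<subseteq> UNIV" "finite D" "UNIV \<subseteq> (\<Union>p\<in>D. U p)"
    by (rule compactE_image[OF compact_manifold cU(2)])
  have ex: "\<exists>P. finite P \<and> (\<forall>(c, B)\<in>P. c \<in> A \<and> B \<in> sets borel \<and> closure B \<subseteq> fst c) \<and>
     disjoint_family_on snd P \<and> (\<Union>(c, B)\<in>P. B) = (\<Union>p\<in>D. U p)"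
    using D(2)
  proof (induction D rule: finite_induct)
    case empty
    show ?case by (rule exI[of _ "{}"]) (simp add: disjoint_family_on_def)
  next
    case (insert p D)
    then obtain P where P: "finite P" "\<forall>(c, B)\<in>P. c \<in> A \<and> B \<in> sets borel \<and> closure B \<subseteq> fst c"
      "disjoint_family_on snd P" "(\<Union>(c, B)\<in>P. B) = (\<Union>p\<in>D. U p)" by blast
    \<comment> \<open>Only what is not yet covered: Borel as a difference of open sets, and disjoint
      from all earlier pieces.\<close>
    let ?B = "U p - (\<Union>p\<in>D. U p)"
    have "?B \<in> sets borel"
      using cU(2) by (intro sets.Diff borel_open open_UN) auto
    moreover have "closure ?B \<subseteq> fst (c p)" using cU(4) closure_mono[of ?B "U p"] by blast
    moreover have "disjoint_family_on snd (insert (c p, ?B) P)"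
      unfolding disjoint_family_on_def
    proof (intro ballI impI)
      have sub: "snd m \<inter> ?B = {}" if "m \<in> P" for m
      proof -
        have "snd m \<subseteq> (\<Union>(c, B)\<in>P. B)" using that by (cases m) auto
        then show ?thesis unfolding P(4) by blast
      qed
      fix m n assume "m \<in> insert (c p, ?B) P" "n \<in> insert (c p, ?B) P" "m \<noteq> n"
      then consider "m \<in> P" "n \<in> P" | "m = (c p, ?B)" "n \<in> P" | "m \<in> P" "n = (c p, ?B)" by blast
      then show "snd m \<inter> snd n = {}"
      proof cases
        case 1
        then show ?thesis using P(3) \<open>m \<noteq> n\<close> unfolding disjoint_family_on_def by blast
      next
        case 2
        then show ?thesis using sub[of n] by (simp add: Int_commute)
      next
        case 3
        then show ?thesis using sub[of m] by simp
      qed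
    qed
    ultimately show ?case
    proof (intro exI[of _ "insert (c p, ?B) P"] conjI)
      show "finite (insert (c p, ?B) P)" using P(1) by simp
      have "(\<Union>(c, B)\<in>insert (c p, ?B) P. B) = ?B \<union> (\<Union>(c, B)\<in>P. B)" by simp
      then show "(\<Union>(c, B)\<in>insert (c p, ?B) P. B) = (\<Union>p\<in>insert p D. U p)"
        unfolding P(4) by blast
    qed (use P(2) cU(1) in simp_all)
  qed
  have "(\<Union>p\<in>D. U p) = UNIV" using D(3) by blast
  from ex[unfolded this] show ?thesis unfolding chart_partition_def .
qed

text \<open>The same choice as inside \<open>integral_form\<close>, so that \<open>L2_inner\<close>
  unfolds literally to a sum over these pieces.\<close>

definition pieces where "pieces = (SOME P. chart_partition A P)"

lemma chart_partition_pieces: "chart_partition A pieces"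
  unfolding pieces_def using chart_partition_exists by (rule someI_ex)

lemma finite_pieces: "finite pieces"
  and pieces_cover: "\<exists>c B. (c, B) \<in> pieces \<and> p \<in> B"
  and pieces_chart: "(c, B) \<in> pieces \<Longrightarrow> c \<in> A"
  and pieces_borel: "(c, B) \<in> pieces \<Longrightarrow> B \<in> sets borel"
  and pieces_closure: "(c, B) \<in> pieces \<Longrightarrow> closure B \<subseteq> fst c"
proof -
  note cp = chart_partition_pieces[unfolded chart_partition_def]
  show "finite pieces" using cp by blast
  show "c \<in> A" "B \<in> sets borel" "closure B \<subseteq> fst c" if "(c, B) \<in> pieces" for c B
    using cp that by auto
  have "p \<in> (\<Union>(c, B)\<in>pieces. B)" using cp by simp
  then show "\<exists>c B. (c, B) \<in> pieces \<and> p \<in> B" by auto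
qed

lemma piece_compact:
  assumes "(c, B) \<in> pieces"
  shows "compact (snd c ` closure B)"
proof (rule compact_continuous_image)
  show "continuous_on (closure B) (snd c)"
    using chart_homeomorphism[OF pieces_chart[OF assms]] pieces_closure[OF assms]
    by (meson continuous_on_subset homeomorphism_cont1)
  show "compact (closure B)"
    using compact_Int_closed[OF compact_manifold closed_closure, of B] by simp
qed

lemma piece_compact_subset:
  assumes "(c, B) \<in> pieces"
  shows "snd c ` closure B \<subseteq> coord_image c"
  using pieces_closure[OF assms] unfolding coord_image_def by (rule image_mono)

lemma piece_subset: "snd c ` B \<subseteq> snd c ` closure B"
  by (intro image_mono closure_subset)

text \<open>The image is the preimage of \<open>B\<close> under the continuous inverse chart, and
  preimages of Borel sets are Borel.\<close>

lemma piece_borel: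
  assumes "(c, B) \<in> pieces"
  shows "snd c ` B \<in> sets borel"
proof -
  note c = pieces_chart[OF assms]
  let ?\<psi> = "inv_into (fst c) (snd c)"
  have "continuous_on (coord_image c) ?\<psi>"
    using chart_homeomorphism[OF c] by (rule homeomorphism_cont2)
  then have "?\<psi> \<in> borel_measurable (restrict_space borel (coord_image c))"
    by (rule borel_measurable_continuous_on_restrict)
  from measurable_sets[OF this pieces_borel[OF assms]]
  have "?\<psi> -` B \<inter> coord_image c \<in> sets borel"
    using open_coord_image[OF c] by (simp add: sets_restrict_space_iff space_restrict_space)
  moreover have "?\<psi> -` B \<inter> coord_image c = snd c ` B"
    using pieces_closure[OF assms] closure_subset[of B] inv_chart[OF c]
    unfolding coord_image_def by (auto simp: image_iff)
  ultimately show ?thesis by simp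
qed

definition L2_density :: "('a, 'n) field2 \<Rightarrow> ('a, 'n) field2 \<Rightarrow> ('a, 'n) chart \<Rightarrow> real ^ 'n \<Rightarrow> real" where
  "L2_density g h c x = tr_prod g h h c x * volume_form g c x"

lemma L2_inner_pieces:
  "L2_inner A g h h = (\<Sum>(c, B)\<in>pieces. LINT x:snd c ` B|lborel. L2_density g h c x)"
  unfolding L2_inner_def integral_form_def pieces_def[symmetric] L2_density_def ..

lemma L2_density_nonneg:
  assumes "g \<in> riem_metrics A" "h \<in> sym_tensor_fields A" "c \<in> A" "x \<in> coord_image c"
  shows "0 \<le> L2_density g h c x"
  unfolding L2_density_def tr_prod_def volume_form_def
  using spd_trace_nonneg[OF riem_metrics_spd[OF assms(1,3,4)] sym_tensor_fields_transpose[OF assms(2-4)]]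
    spd_det_pos[OF riem_metrics_spd[OF assms(1,3,4)]]
  by (simp add: less_imp_le)

lemma piece_integral_nonneg:
  assumes "g \<in> riem_metrics A" "h \<in> sym_tensor_fields A" "(c, B) \<in> pieces"
  shows "0 \<le> (LINT x:snd c ` B|lborel. L2_density g h c x)"
proof (rule set_integral_nonneg_lborel)
  fix x assume "x \<in> snd c ` B"
  then have "x \<in> coord_image c"
    by (intro subsetD[OF piece_compact_subset[OF assms(3)]] subsetD[OF piece_subset])
  then show "0 \<le> L2_density g h c x"
    by (rule L2_density_nonneg[OF assms(1,2) pieces_chart[OF assms(3)]])
qed

text \<open>All summands are nonnegative. This passes from a single piece to the global
  norm.\<close>

lemma piece_integral_le_L2_inner:
  assumes "g \<in> riem_metrics A" "h \<in> sym_tensor_fields A" "(c, B) \<in> pieces"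
  shows "(LINT x:snd c ` B|lborel. L2_density g h c x) \<le> L2_inner A g h h"
  unfolding L2_inner_pieces
  using member_le_sum[OF assms(3), of "\<lambda>(c, B). LINT x:snd c ` B|lborel. L2_density g h c x"]
    piece_integral_nonneg[OF assms(1,2)] finite_pieces by auto

lemma L2_norm_nonneg:
  assumes "g \<in> riem_metrics A" "h \<in> sym_tensor_fields A"
  shows "0 \<le> L2_norm A g h"
  unfolding L2_norm_def L2_inner_pieces
  using piece_integral_nonneg[OF assms] by (auto intro!: sum_nonneg)

lemma tr_prod_scale:
  "tr_prod g (\<lambda>c x. m *\<^sub>R h c x) (\<lambda>c x. m *\<^sub>R h c x) c x = m\<^sup>2 * tr_prod g h h c x"
  unfolding tr_prod_def trace_def matrix_matrix_mult_def
  by (simp add: sum_distrib_left sum_distrib_right power2_eq_square mult_ac)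

lemma L2_norm_scale: "L2_norm A g (\<lambda>c x. m *\<^sub>R h c x) = \<bar>m\<bar> * L2_norm A g h"
proof -
  have "L2_inner A g (\<lambda>c x. m *\<^sub>R h c x) (\<lambda>c x. m *\<^sub>R h c x) = m\<^sup>2 * L2_inner A g h h"
    unfolding L2_inner_pieces L2_density_def tr_prod_scale sum_distrib_left
    by (intro sum.cong) (auto simp: mult.assoc)
  then show ?thesis by (simp add: L2_norm_def real_sqrt_mult)
qed

section \<open>Velocities and continuity uniform on compact sets\<close>

lemma has_velocity_sym:
  "has_velocity A \<gamma> v t I \<Longrightarrow> v \<in> sym_tensor_fields A"
  by (simp add: has_velocity_def limitin_def topspace_smooth_topology)

lemma has_velocity_entry_derivative:
  assumes v: "has_velocity A \<gamma> v t I" and c: "c \<in> A" and x: "x \<in> coord_image c"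
  shows "((\<lambda>s. \<gamma> s c x $ i $ j) has_real_derivative v c x $ i $ j) (at t within I)"
  unfolding has_field_derivative_iff tendsto_iff dist_real_def
  using limitin_smooth_uniform[OF v[unfolded has_velocity_def] c, of "{x}"] x
  by (auto simp: divide_inverse mult.commute)

text \<open>Near t the difference quotients are within 1 of the velocity, which is bounded by M on
  \<open>K\<close>; so increments are at most (M + 1) |s - t| there.\<close>

lemma has_velocity_uniform_continuity:
  assumes v: "has_velocity A \<gamma> v t I" and c: "c \<in> A" and K: "compact K" "K \<subseteq> coord_image c" and e: "e > 0"
  shows "eventually (\<lambda>s. \<forall>x\<in>K. \<bar>\<gamma> s c x $ i $ j - \<gamma> t c x $ i $ j\<bar> < e) (at t within I)"
proof -
  have "continuous_on K (v c)"
    using sym_tensor_fields_continuous[OF has_velocity_sym[OF v] c] K(2) by (rule continuous_on_subset)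
  then have "continuous_on K (\<lambda>x. v c x $ i $ j)" by (intro continuous_on_component)
  then have "bounded ((\<lambda>x. v c x $ i $ j) ` K)"
    using K(1) by (intro compact_imp_bounded compact_continuous_image)
  then obtain M where M: "M > 0" "\<And>x. x \<in> K \<Longrightarrow> \<bar>v c x $ i $ j\<bar> \<le> M"
    unfolding bounded_pos by auto
  have "eventually (\<lambda>s. \<forall>x\<in>K. \<bar>(\<gamma> s c x $ i $ j - \<gamma> t c x $ i $ j) / (s - t) - v c x $ i $ j\<bar> < 1) (at t within I)"
    using limitin_smooth_uniform[OF v[unfolded has_velocity_def] c K zero_less_one]
    by (simp add: divide_inverse mult.commute)
  moreover have "eventually (\<lambda>s. s \<noteq> t \<and> \<bar>s - t\<bar> < e / (M + 1)) (at t within I)"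
    using e M(1) unfolding eventually_at by (intro exI[of _ "e / (M + 1)"]) (auto simp: dist_real_def)
  ultimately show ?thesis
  proof eventually_elim
    case (elim s)
    show ?case
    proof
      fix x assume x: "x \<in> K"
      let ?q = "(\<gamma> s c x $ i $ j - \<gamma> t c x $ i $ j) / (s - t)"
      have "\<bar>?q - v c x $ i $ j\<bar> < 1" using elim(1) x by blast
      then have "\<bar>?q\<bar> \<le> M + 1" using M(2)[OF x] by linarith
      have "\<bar>\<gamma> s c x $ i $ j - \<gamma> t c x $ i $ j\<bar> = \<bar>s - t\<bar> * \<bar>?q\<bar>"
        using elim(2) by (simp add: abs_divide)
      also have "\<dots> \<le> \<bar>s - t\<bar> * (M + 1)" using \<open>\<bar>?q\<bar> \<le> M + 1\<close> by (intro mult_left_mono) auto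
      also have "\<dots> < e" using elim(2) M(1) by (simp add: less_divide_eq)
      finally show "\<bar>\<gamma> s c x $ i $ j - \<gamma> t c x $ i $ j\<bar> < e" .
    qed
  qed
qed

lemma continuous_map_uniform_continuity:
  assumes f: "continuous_map (top_of_set I) (smooth_topology A) f" and t: "t \<in> I"
    and c: "c \<in> A" and K: "compact K" "K \<subseteq> coord_image c" and e: "e > 0"
  shows "eventually (\<lambda>s. \<forall>x\<in>K. \<bar>f s c x $ i $ j - f t c x $ i $ j\<bar> < e) (at t within I)"
proof -
  have "f t \<in> sym_tensor_fields A"
    using f t by (auto simp: continuous_map_def topspace_smooth_topology)
  note ft = this
  then have mem: "f t \<in> nbhd (f t) c K [] i j e"
    using e by (simp add: nbhd_def)
  have "openin (top_of_set I) {s \<in> topspace (top_of_set I). f s \<in> nbhd (f t) c K [] i j e}"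
    by (rule openin_continuous_map_preimage[OF f openin_nbhd[OF ft c K e]])
  then obtain T where T: "open T" "{s \<in> I. f s \<in> nbhd (f t) c K [] i j e} = I \<inter> T"
    unfolding openin_open by auto
  then show ?thesis
    unfolding eventually_at_topological using t mem by (intro exI[of _ T]) (auto simp: nbhd_def)
qed

end

text \<open>The step from s to t costs e / 2 uniformly in the point, the step in the point at fixed
  t the other e / 2.\<close>

lemma joint_continuity:
  fixes f :: "'t::metric_space \<Rightarrow> 'x::metric_space \<Rightarrow> real"
  assumes u: "\<And>t e. t \<in> I \<Longrightarrow> e > 0 \<Longrightarrow> eventually (\<lambda>s. \<forall>x\<in>K. \<bar>f s x - f t x\<bar> < e) (at t within I)"
    and f: "\<And>t. t \<in> I \<Longrightarrow> continuous_on K (f t)"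
  shows "continuous_on (I \<times> K) (\<lambda>(t, x). f t x)"
  unfolding continuous_on_iff
proof (intro ballI allI impI, clarify)
  fix t x and e :: real assume t: "t \<in> I" and x: "x \<in> K" and e: "e > 0"
  obtain d where d: "d > 0" "\<And>s. s \<in> I \<Longrightarrow> s \<noteq> t \<Longrightarrow> dist s t < d \<Longrightarrow> \<forall>x\<in>K. \<bar>f s x - f t x\<bar> < e / 2"
    using u[OF t, of "e / 2"] e unfolding eventually_at by auto
  obtain d' where d': "d' > 0" "\<And>y. y \<in> K \<Longrightarrow> dist y x < d' \<Longrightarrow> \<bar>f t y - f t x\<bar> < e / 2"
    using f[OF t] x e unfolding continuous_on_iff dist_real_def by (metis half_gt_zero)
  have "\<bar>f s y - f t x\<bar> < e" if "s \<in> I" "y \<in> K" "dist (s, y) (t, x) < min d d'" for s y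
  proof -
    have "dist s t < d" "dist y x < d'"
      using that(3) dist_fst_le[of "(s, y)" "(t, x)"] dist_snd_le[of "(s, y)" "(t, x)"] by auto
    then have "\<bar>f s y - f t y\<bar> < e / 2" "\<bar>f t y - f t x\<bar> < e / 2"
      \<comment> \<open>The filter says nothing about s = t, where the first difference is
        zero.\<close>
      using d(2)[of s] d'(2) that e by (cases "s = t"; auto)+
    then show ?thesis by linarith
  qed
  then show "\<exists>d>0. \<forall>p\<in>I \<times> K. dist p (t, x) < d \<longrightarrow> dist (case p of (t, x) \<Rightarrow> f t x) (f t x) < e"
    using d(1) d'(1) by (intro exI[of _ "min d d'"]) (auto simp: dist_real_def)
qed

context closed_manifold
begin

section \<open>A single arc with a continuous velocity field\<close>

context
  fixes \<gamma> \<gamma>' a b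
  assumes metrics: "\<And>t. t \<in> {a..b} \<Longrightarrow> \<gamma> t \<in> riem_metrics A"
    and velocities: "\<And>t. t \<in> {a..b} \<Longrightarrow> has_velocity A \<gamma> (\<gamma>' t) t {a..b}"
    and velocity_continuous: "continuous_map (top_of_set {a..b}) (smooth_topology A) \<gamma>'"
begin

lemma arc_spd:
  assumes "c \<in> A" "K \<subseteq> coord_image c" "p \<in> {a..b} \<times> K"
  shows "spd (\<gamma> (fst p) c (snd p))"
  by (rule riem_metrics_spd[OF metrics assms(1)]) (use assms(2,3) in auto)

text \<open>Uniform continuity in time comes, for the curve, from the existence of velocities and,
  for the velocities, from their continuity in the smooth topology.\<close>

lemma arc_joint_continuity:
  assumes c: "c \<in> A" and K: "compact K" "K \<subseteq> coord_image c"
  shows "continuous_on ({a..b} \<times> K) (\<lambda>p. \<gamma> (fst p) c (snd p))"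
    and "continuous_on ({a..b} \<times> K) (\<lambda>p. \<gamma>' (fst p) c (snd p))"
proof -
  have cont: "continuous_on K (\<lambda>x. h c x $ i $ j)" if "h \<in> sym_tensor_fields A" for h i j
    by (intro continuous_on_component continuous_on_subset[OF sym_tensor_fields_continuous[OF that c] K(2)])
  have "continuous_on ({a..b} \<times> K) (\<lambda>(t, x). \<gamma> t c x $ i $ j)" for i j
    using riem_metrics_sym[OF metrics] velocities
    by (intro joint_continuity has_velocity_uniform_continuity[OF _ c K] cont) auto
  then show "continuous_on ({a..b} \<times> K) (\<lambda>p. \<gamma> (fst p) c (snd p))"
    by (simp add: continuous_on_matrix_entries case_prod_unfold)
  have "continuous_on ({a..b} \<times> K) (\<lambda>(t, x). \<gamma>' t c x $ i $ j)" for i j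
    using has_velocity_sym[OF velocities]
    by (intro joint_continuity continuous_map_uniform_continuity[OF velocity_continuous _ c K] cont) auto
  then show "continuous_on ({a..b} \<times> K) (\<lambda>p. \<gamma>' (fst p) c (snd p))"
    by (simp add: continuous_on_matrix_entries case_prod_unfold)
qed

lemma arc_density_continuity:
  assumes c: "c \<in> A" and K: "compact K" "K \<subseteq> coord_image c"
  shows "continuous_on ({a..b} \<times> K) (\<lambda>(t, x). L2_density (\<gamma> t) (\<gamma>' t) c x)"
proof -
  note cont = arc_joint_continuity[OF assms] and spd = arc_spd[OF c K(2)]
  have "det (\<gamma> (fst p) c (snd p)) \<noteq> 0" if "p \<in> {a..b} \<times> K" for p
    using spd_det_pos[OF spd[OF that]] by simp
  then show ?thesis
    unfolding L2_density_def tr_prod_def volume_form_def case_prod_unfold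
    by (intro continuous_on_mult continuous_on_trace continuous_on_matrix_mult continuous_on_matrix_inv
        continuous_on_real_sqrt continuous_on_det_matrix cont)
qed

lemma arc_speed_continuous: "continuous_on {a..b} (\<lambda>t. L2_norm A (\<gamma> t) (\<gamma>' t))"
  unfolding L2_norm_def L2_inner_pieces
proof (intro continuous_on_real_sqrt continuous_on_sum)
  fix p assume "p \<in> pieces"
  then obtain c B where p: "p = (c, B)" "(c, B) \<in> pieces" by (cases p) auto
  have "continuous_on {a..b} (\<lambda>t. LINT x:snd c ` B|lborel. L2_density (\<gamma> t) (\<gamma>' t) c x)"
    by (rule continuous_on_set_integral_parameter[OF arc_density_continuity[OF pieces_chart
      piece_compact piece_compact_subset]]) (use p in \<open>auto intro: piece_compact piece_borel piece_subset[THEN subsetD]\<close>)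
  then show "continuous_on {a..b} (\<lambda>t. case p of (c, B) \<Rightarrow> LINT x:snd c ` B|lborel. L2_density (\<gamma> t) (\<gamma>' t) c x)"
    by (simp add: p)
qed

text \<open>The weight \<open>w\<close> is fixed in time. It will be the difference of
  \<open>sep_fun v\<close> at the ends of a path, for which the total increment of \<Phi> is a
  squared L2 norm.\<close>

lemma arc_estimate:
  fixes w :: "real ^ 'n \<Rightarrow> real" and v :: "real ^ 'n"
  assumes ab: "a \<le> b" and cB: "(c, B) \<in> pieces" and w: "continuous_on (snd c ` closure B) w"
  defines "\<Phi> \<equiv> \<lambda>t. LINT x:snd c ` B|lborel. w x * sep_fun v (\<gamma> t c x)"
  shows "\<Phi> b - \<Phi> a \<le> integral {a..b}
    (\<lambda>t. sqrt (LINT x:snd c ` B|lborel. (w x)\<^sup>2) * sqrt (CARD('n) + 2) * L2_norm A (\<gamma> t) (\<gamma>' t))"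
proof -
  define K where "K = snd c ` closure B"
  define E where "E = snd c ` B"
  note c = pieces_chart[OF cB]
  have K: "compact K" "K \<subseteq> coord_image c" and E: "E \<in> sets borel" "E \<subseteq> K"
    unfolding K_def E_def
    by (intro piece_compact[OF cB] piece_compact_subset[OF cB] piece_borel[OF cB] piece_subset)+
  note w = w[folded K_def]
  note cont = arc_joint_continuity[OF c K] and spd = arc_spd[OF c K(2)]
  let ?d = "\<lambda>t x. sep_fun_deriv v (\<gamma> t c x) (\<gamma>' t c x)"
  let ?W = "sqrt (LINT x:E|lborel. (w x)\<^sup>2)" and ?C = "sqrt (real (CARD('n) + 2))"
  have wp: "continuous_on ({a..b} \<times> K) (\<lambda>p. w (snd p))"
    by (rule continuous_on_compose2[OF w]) (auto intro: continuous_intros)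
  have cs: "continuous_on ({a..b} \<times> K) (\<lambda>(t, x). w x * sep_fun v (\<gamma> t c x))"
    unfolding case_prod_unfold by (intro continuous_on_mult wp continuous_on_sep_fun cont spd)
  have cd0: "continuous_on ({a..b} \<times> K) (\<lambda>(t, x). ?d t x)"
    unfolding case_prod_unfold by (intro continuous_on_sep_fun_deriv cont spd)
  then have cd: "continuous_on ({a..b} \<times> K) (\<lambda>(t, x). w x * ?d t x)"
    unfolding case_prod_unfold by (intro continuous_on_mult wp)
  have der: "(\<Phi> has_real_derivative (LINT x:E|lborel. w x * ?d t x)) (at t within {a..b})"
    if t: "t \<in> {a..b}" for t
    unfolding \<Phi>_def E_def[symmetric]
  proof (rule has_real_derivative_set_integral[OF continuous_on_slice[OF cs] cd _ K(1) E t])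
    fix s x assume s: "s \<in> {a..b}" and x: "x \<in> K"
    have "((\<lambda>r. sep_fun v (\<gamma> r c x)) has_real_derivative ?d s x) (at s within {a..b})"
      using x K(2) spd[of "(s, x)"] s
      by (intro has_real_derivative_sep_fun has_velocity_entry_derivative[OF velocities[OF s] c]) auto
    then show "((\<lambda>r. w x * sep_fun v (\<gamma> r c x)) has_real_derivative w x * ?d s x) (at s within {a..b})"
      by (rule DERIV_cmult)
  qed
  \<comment> \<open>Once the increment is an integral over time, the integrands can be compared for
    each t.\<close>
  have "((\<lambda>t. LINT x:E|lborel. w x * ?d t x) has_integral \<Phi> b - \<Phi> a) {a..b}"
    by (rule fundamental_theorem_of_calculus[OF ab])
       (use der in \<open>auto simp: has_real_derivative_iff_has_vector_derivative\<close>)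
  moreover have "((\<lambda>t. ?W * ?C * L2_norm A (\<gamma> t) (\<gamma>' t)) has_integral
      integral {a..b} (\<lambda>t. ?W * ?C * L2_norm A (\<gamma> t) (\<gamma>' t))) {a..b}"
    by (intro integrable_integral integrable_continuous_real continuous_intros arc_speed_continuous)
  moreover have "(LINT x:E|lborel. w x * ?d t x) \<le> ?W * ?C * L2_norm A (\<gamma> t) (\<gamma>' t)"
    if t: "t \<in> {a..b}" for t
  proof -
    note i = set_integrable_compact_subset[OF K(1) _ E]
    have cdt: "continuous_on K (?d t)" using continuous_on_slice[OF cd0 t] .
    have cdens: "continuous_on K (L2_density (\<gamma> t) (\<gamma>' t) c)"
      using continuous_on_slice[OF arc_density_continuity[OF c K] t] .
    \<comment> \<open>The matrix inequality \<open>sep_fun_deriv_bound\<close>, integrated over the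
      piece.\<close>
    have "(LINT x:E|lborel. (?d t x)\<^sup>2) \<le> (LINT x:E|lborel. (CARD('n) + 2) * L2_density (\<gamma> t) (\<gamma>' t) c x)"
    proof (rule set_integral_mono)
      fix x assume "x \<in> E"
      then have x: "x \<in> coord_image c" using E K by blast
      show "(?d t x)\<^sup>2 \<le> (CARD('n) + 2) * L2_density (\<gamma> t) (\<gamma>' t) c x"
        unfolding L2_density_def tr_prod_def volume_form_def
        by (intro sep_fun_deriv_bound riem_metrics_spd[OF metrics[OF t] c x]
            sym_tensor_fields_transpose[OF has_velocity_sym[OF velocities[OF t]] c x])
    qed (intro i continuous_intros cdt cdens)+
    also have "\<dots> = (CARD('n) + 2) * (LINT x:E|lborel. L2_density (\<gamma> t) (\<gamma>' t) c x)"
      by simp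
    also have "\<dots> \<le> (CARD('n) + 2) * L2_inner A (\<gamma> t) (\<gamma>' t) (\<gamma>' t)"
      unfolding E_def
      by (intro mult_left_mono piece_integral_le_L2_inner metrics[OF t] has_velocity_sym[OF velocities[OF t]] cB) simp
    finally have "sqrt (LINT x:E|lborel. (?d t x)\<^sup>2) \<le> ?C * L2_norm A (\<gamma> t) (\<gamma>' t)"
      unfolding L2_norm_def real_sqrt_mult[symmetric] by (simp add: add.commute)
    moreover have "0 \<le> ?W" by (intro real_sqrt_ge_zero set_integral_nonneg_lborel) simp
    ultimately have "?W * sqrt (LINT x:E|lborel. (?d t x)\<^sup>2) \<le> ?W * (?C * L2_norm A (\<gamma> t) (\<gamma>' t))"
      by (rule mult_left_mono)
    moreover have "\<bar>LINT x:E|lborel. w x * ?d t x\<bar> \<le> ?W * sqrt (LINT x:E|lborel. (?d t x)\<^sup>2)"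
      by (rule set_integral_Cauchy_Schwarz; intro i continuous_intros w cdt)
    ultimately show ?thesis by (simp add: mult.assoc)
  qed
  ultimately show ?thesis unfolding E_def by (rule has_integral_le)
qed

end

end

section \<open>Paths, lengths and the distance\<close>

lemma at_within_Icc_neq_bot:
  fixes a b t :: real
  assumes "a < b" "t \<in> {a..b}"
  shows "at t within {a..b} \<noteq> bot"
  using assms by (simp add: trivial_limit_within islimpt_Icc)

lemma has_velocity_cong:
  assumes "\<And>s. s \<in> I \<Longrightarrow> \<gamma> s = \<delta> s" "t \<in> I" "has_velocity A \<gamma> v t I"
  shows "has_velocity A \<delta> v t I"
proof -
  have "eventually (\<lambda>s. s \<in> I) (at t within I)" by (simp add: eventually_at_filter)
  then have "eventually (\<lambda>s. (\<lambda>c x. (\<gamma> s c x - \<gamma> t c x) /\<^sub>R (s - t)) = (\<lambda>c x. (\<delta> s c x - \<delta> t c x) /\<^sub>R (s - t)))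
      (at t within I)"
    by eventually_elim (simp add: assms)
  from limitin_transform_eventually[OF this assms(3)[unfolded has_velocity_def]]
  show ?thesis unfolding has_velocity_def .
qed

text \<open>At interior points both filters are the two-sided one. At break points the notions can
  differ, so speeds are compared outside finite sets.\<close>

lemma has_velocity_interior:
  assumes "{a..b} \<subseteq> {0..1}" "a < t" "t < b" "has_velocity A \<gamma> v t {a..b}"
  shows "has_velocity A \<gamma> v t {0..1}"
proof -
  have "0 < t" "t < 1" using assms(1-3) by auto
  then have "at t within {a..b} = at t" "at t within {0..1} = at t"
    using assms by (auto intro: at_within_Icc_at)
  then show ?thesis using assms(4) by (simp add: has_velocity_def)
qed

lemma finite_affine_preimage:
  fixes S :: "real set"
  assumes "m \<noteq> 0" "finite S"
  shows "finite {s. m * s + q \<in> S}"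
proof -
  have "inj (\<lambda>s. m * s + q)" using assms(1) by (auto intro: injI)
  from finite_vimageI[OF assms(2) this] show ?thesis by (simp add: vimage_def)
qed

context closed_manifold
begin

lemma velocity_eqI:
  assumes "has_velocity A \<gamma> v t {0..1}" "t \<in> {0..1}"
  shows "velocity A \<gamma> t = v"
  unfolding velocity_def
proof (rule the_equality)
  show "u = v" if "has_velocity A \<gamma> u t {0..1}" for u
    using that assms at_within_Icc_neq_bot[of 0 1 t] unfolding has_velocity_def
    by (auto intro: limitin_smooth_topology_unique)
qed (rule assms(1))

text \<open>Chain rule for t -> m t + q: the limit of difference quotients is composed with this map
  and then multiplied by m, a continuous operation in the smooth topology.\<close>

lemma has_velocity_affine:
  assumes m: "m \<noteq> 0" and img: "\<And>s. s \<in> J \<Longrightarrow> m * s + q \<in> I"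
    and v: "has_velocity A \<gamma> v (m * t + q) I"
  shows "has_velocity A (\<lambda>s. \<gamma> (m * s + q)) (\<lambda>c x. m *\<^sub>R v c x) t J"
proof -
  let ?\<phi> = "\<lambda>s. m * s + q"
  let ?Q = "\<lambda>r c x. (\<gamma> r c x - \<gamma> (?\<phi> t) c x) /\<^sub>R (r - ?\<phi> t)"
  have lim: "filterlim ?\<phi> (at (?\<phi> t) within I) (at t within J)"
    unfolding filterlim_at
  proof (intro conjI)
    show "eventually (\<lambda>s. ?\<phi> s \<in> I \<and> ?\<phi> s \<noteq> ?\<phi> t) (at t within J)"
      using m img by (auto simp: eventually_at_filter)
    show "filterlim ?\<phi> (nhds (?\<phi> t)) (at t within J)" by (intro tendsto_intros)
  qed
  have "limitin (smooth_topology A) (?Q \<circ> ?\<phi>) v (at t within J)"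
    unfolding limitin_def
  proof (intro conjI allI impI)
    show "v \<in> topspace (smooth_topology A)" using v by (simp add: has_velocity_def limitin_def)
    fix U assume "openin (smooth_topology A) U \<and> v \<in> U"
    then have "eventually (\<lambda>r. ?Q r \<in> U) (at (?\<phi> t) within I)"
      using v by (simp add: has_velocity_def limitin_def)
    from eventually_compose_filterlim[OF this lim]
    show "eventually (\<lambda>s. (?Q \<circ> ?\<phi>) s \<in> U) (at t within J)" by (simp only: o_def)
  qed
  from continuous_map_limit[OF continuous_map_scale[OF m] this]
  have "limitin (smooth_topology A) (\<lambda>s c x. m *\<^sub>R ?Q (?\<phi> s) c x) (\<lambda>c x. m *\<^sub>R v c x) (at t within J)"
    by (simp add: o_def)
  moreover have "m *\<^sub>R ?Q (?\<phi> s) c x = (\<gamma> (?\<phi> s) c x - \<gamma> (?\<phi> t) c x) /\<^sub>R (s - t)" for s c x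
  proof -
    have "m * inverse (m * s + q - (m * t + q)) = inverse (s - t)"
      \<comment> \<open>For s = t both sides vanish, since \<open>inverse 0 = 0\<close>.\<close>
      using m by (cases "s = t") (auto simp: field_simps)
    then show ?thesis by simp
  qed
  ultimately show ?thesis unfolding has_velocity_def by (simp only:)
qed

text \<open>Agreement is asked on \<open>J\<close> alone, so that \<delta> may follow another
  formula elsewhere, as in a concatenation.\<close>

lemma C1_curve_on_affine:
  assumes m: "m \<noteq> 0" and img: "\<And>s. s \<in> J \<Longrightarrow> m * s + q \<in> I" and \<gamma>: "C1_curve_on A I \<gamma>"
    and \<delta>: "\<And>s. s \<in> J \<Longrightarrow> \<delta> s = \<gamma> (m * s + q)"
  shows "C1_curve_on A J \<delta>"
proof -
  obtain \<gamma>' where \<gamma>': "\<And>t. t \<in> I \<Longrightarrow> has_velocity A \<gamma> (\<gamma>' t) t I"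
    "continuous_map (top_of_set I) (smooth_topology A) \<gamma>'"
    using \<gamma> unfolding C1_curve_on_def by blast
  have "has_velocity A \<delta> (\<lambda>c x. m *\<^sub>R \<gamma>' (m * t + q) c x) t J" if "t \<in> J" for t
    by (rule has_velocity_cong[OF _ that has_velocity_affine[OF m img \<gamma>'(1)[OF img[OF that]]]])
       (auto simp: \<delta>)
  moreover have "continuous_map (top_of_set J) (smooth_topology A) (\<lambda>t c x. m *\<^sub>R \<gamma>' (m * t + q) c x)"
  proof -
    have "continuous_map (top_of_set J) (top_of_set I) (\<lambda>s. m * s + q)"
      using img by (auto intro!: continuous_intros)
    from continuous_map_compose[OF continuous_map_compose[OF this \<gamma>'(2)] continuous_map_scale[OF m]]
    show ?thesis by (simp add: o_def)
  qed
  ultimately show ?thesis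
    unfolding C1_curve_on_def by (intro exI[of _ "\<lambda>t c x. m *\<^sub>R \<gamma>' (m * t + q) c x"]) auto
qed

section \<open>Speed and length of piecewise C1 paths\<close>

definition speed :: "(real \<Rightarrow> ('a, 'n) field2) \<Rightarrow> real \<Rightarrow> real" where
  "speed \<gamma> t = L2_norm A (\<gamma> t) (velocity A \<gamma> t)"

lemma L2_length_speed: "L2_length A \<gamma> = integral {0..1} (speed \<gamma>)"
  by (simp add: L2_length_def speed_def[abs_def])

text \<open>The field \<open>\<gamma>'\<close> is continuous up to the ends of the arc, whereas
  \<open>velocity\<close> is under control only inside; the fourth conjunct says that both give the
  same length.\<close>

definition smooth_arc where
  "smooth_arc \<gamma> \<gamma>' a b \<longleftrightarrow> (\<forall>t\<in>{a..b}. \<gamma> t \<in> riem_metrics A) \<and>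
     (\<forall>t\<in>{a..b}. has_velocity A \<gamma> (\<gamma>' t) t {a..b}) \<and>
     continuous_map (top_of_set {a..b}) (smooth_topology A) \<gamma>' \<and>
     (speed \<gamma> has_integral integral {a..b} (\<lambda>t. L2_norm A (\<gamma> t) (\<gamma>' t))) {a..b} \<and>
     (\<forall>t\<in>{a<..<b}. has_velocity A \<gamma> (velocity A \<gamma> t) t {0..1})"

lemma smooth_arcD:
  assumes "smooth_arc \<gamma> \<gamma>' a b"
  shows "\<And>t. t \<in> {a..b} \<Longrightarrow> \<gamma> t \<in> riem_metrics A"
    and "\<And>t. t \<in> {a..b} \<Longrightarrow> has_velocity A \<gamma> (\<gamma>' t) t {a..b}"
    and "continuous_map (top_of_set {a..b}) (smooth_topology A) \<gamma>'"
    and "(speed \<gamma> has_integral integral {a..b} (\<lambda>t. L2_norm A (\<gamma> t) (\<gamma>' t))) {a..b}"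
    and "\<And>t. a < t \<Longrightarrow> t < b \<Longrightarrow> has_velocity A \<gamma> (velocity A \<gamma> t) t {0..1}"
  using assms by (auto simp: smooth_arc_def)

lemma piecewise_C1_path_subdivision:
  "piecewise_C1_path A \<gamma> \<longleftrightarrow> (\<forall>t\<in>{0..1}. \<gamma> t \<in> riem_metrics A) \<and>
     (\<exists>T. subdivision T \<and> (\<forall>a b. consecutive T a b \<longrightarrow> C1_curve_on A {a..b} \<gamma>))"
  unfolding piecewise_C1_path_def subdivision_def consecutive_def
  by (rule conj_cong[OF refl], rule iff_exI) auto

lemma piecewise_C1_path_arcs:
  assumes \<gamma>: "piecewise_C1_path A \<gamma>"
  shows "\<exists>T. subdivision T \<and> (\<forall>a b. consecutive T a b \<longrightarrow> (\<exists>\<gamma>'. smooth_arc \<gamma> \<gamma>' a b))"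
proof -
  obtain T where T: "subdivision T"
    and C1: "\<forall>a b. consecutive T a b \<longrightarrow> C1_curve_on A {a..b} \<gamma>"
    and metrics: "\<forall>t\<in>{0..1}. \<gamma> t \<in> riem_metrics A"
    using \<gamma> unfolding piecewise_C1_path_subdivision by blast
  show ?thesis
  proof (intro exI[of _ T] conjI T allI impI)
    fix a b assume ab: "consecutive T a b"
    have sub: "{a..b} \<subseteq> {0..1}" using ab T by (auto simp: consecutive_def subdivision_def)
    obtain \<gamma>' where \<gamma>': "\<And>t. t \<in> {a..b} \<Longrightarrow> has_velocity A \<gamma> (\<gamma>' t) t {a..b}"
      "continuous_map (top_of_set {a..b}) (smooth_topology A) \<gamma>'"
    proof -
      have "C1_curve_on A {a..b} \<gamma>" using C1 ab by blast
      then show ?thesis using that unfolding C1_curve_on_def by blast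
    qed
    have m: "\<gamma> t \<in> riem_metrics A" if "t \<in> {a..b}" for t using metrics sub that by blast
    have vel: "has_velocity A \<gamma> (\<gamma>' t) t {0..1}" if "t \<in> {a<..<b}" for t
      using that by (intro has_velocity_interior[OF sub _ _ \<gamma>'(1)]) auto
    have veq: "velocity A \<gamma> t = \<gamma>' t" if "t \<in> {a<..<b}" for t
      using that sub by (intro velocity_eqI vel) auto
    let ?N = "\<lambda>t. L2_norm A (\<gamma> t) (\<gamma>' t)"
    have "(?N has_integral integral {a..b} ?N) {a..b}"
      by (intro integrable_integral integrable_continuous_real arc_speed_continuous m \<gamma>')
    then have "(speed \<gamma> has_integral integral {a..b} ?N) {a..b}"
    \<comment> \<open>The two speeds may differ at a and b, which the integral ignores.\<close>
    proof (rule has_integral_spike_finite[of "{a, b}", rotated 2])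
      show "speed \<gamma> t = ?N t" if "t \<in> {a..b} - {a, b}" for t
        using that veq[of t] by (simp add: speed_def)
    qed simp
    then have "smooth_arc \<gamma> \<gamma>' a b"
      unfolding smooth_arc_def using m \<gamma>' vel veq by simp
    then show "\<exists>\<gamma>'. smooth_arc \<gamma> \<gamma>' a b" by blast
  qed
qed

lemma speed_integrable: "piecewise_C1_path A \<gamma> \<Longrightarrow> speed \<gamma> integrable_on {0..1}"
  and L2_length_nonneg: "piecewise_C1_path A \<gamma> \<Longrightarrow> 0 \<le> L2_length A \<gamma>"
proof -
  assume "piecewise_C1_path A \<gamma>"
  note \<gamma> = this
  obtain T where T: "subdivision T"
    and arcs: "\<forall>a b. consecutive T a b \<longrightarrow> (\<exists>\<gamma>'. smooth_arc \<gamma> \<gamma>' a b)"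
    using piecewise_C1_path_arcs[OF \<gamma>] by blast
  \<comment> \<open>\<open>0 - 0\<close> is the increment of the zero function, so the subdivision
    lemma yields nonnegativity too.\<close>
  have piece: "speed \<gamma> integrable_on {a..b} \<and> 0 - 0 \<le> integral {a..b} (speed \<gamma>)"
    if "consecutive T a b" for a b
  proof -
    obtain \<gamma>' where "smooth_arc \<gamma> \<gamma>' a b" using arcs \<open>consecutive T a b\<close> by blast
    note \<gamma>' = smooth_arcD[OF this]
    have "0 \<le> integral {a..b} (\<lambda>t. L2_norm A (\<gamma> t) (\<gamma>' t))"
      by (rule integral_nonneg)
        (auto intro!: integrable_continuous_real arc_speed_continuous L2_norm_nonneg \<gamma>' has_velocity_sym[OF \<gamma>'(2)])
    then show ?thesis using \<gamma>'(4) by (auto simp: has_integral_iff)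
  qed
  show "speed \<gamma> integrable_on {0..1}" by (rule integral_bound_subdivision(1)[OF T piece])
  show "0 \<le> L2_length A \<gamma>"
    unfolding L2_length_speed using integral_bound_subdivision(2)[OF T piece] by simp
qed

text \<open>The increments telescope over the arcs, while the factor in front of the length is the
  same on each arc.\<close>

lemma path_estimate:
  fixes w :: "real ^ 'n \<Rightarrow> real" and v :: "real ^ 'n"
  assumes \<gamma>: "piecewise_C1_path A \<gamma>" and cB: "(c, B) \<in> pieces"
    and w: "continuous_on (snd c ` closure B) w"
  shows "(LINT x:snd c ` B|lborel. w x * sep_fun v (\<gamma> 1 c x)) - (LINT x:snd c ` B|lborel. w x * sep_fun v (\<gamma> 0 c x))
      \<le> sqrt (LINT x:snd c ` B|lborel. (w x)\<^sup>2) * sqrt (CARD('n) + 2) * L2_length A \<gamma>"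
proof -
  obtain T where T: "subdivision T"
    and arcs: "\<forall>a b. consecutive T a b \<longrightarrow> (\<exists>\<gamma>'. smooth_arc \<gamma> \<gamma>' a b)"
    using piecewise_C1_path_arcs[OF \<gamma>] by blast
  let ?W = "sqrt (LINT x:snd c ` B|lborel. (w x)\<^sup>2) * sqrt (CARD('n) + 2)"
  let ?\<Phi> = "\<lambda>t. LINT x:snd c ` B|lborel. w x * sep_fun v (\<gamma> t c x)"
  have "?\<Phi> 1 - ?\<Phi> 0 \<le> integral {0..1} (\<lambda>t. ?W * speed \<gamma> t)"
  proof (rule integral_bound_subdivision(2)[OF T, where \<Phi> = ?\<Phi>])
    fix a b assume ab: "consecutive T a b"
    then have "a < b" by (simp add: consecutive_def)
    obtain \<gamma>' where "smooth_arc \<gamma> \<gamma>' a b" using arcs ab by blast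
    note \<gamma>' = smooth_arcD[OF this]
    let ?N = "\<lambda>t. L2_norm A (\<gamma> t) (\<gamma>' t)"
    have "?\<Phi> b - ?\<Phi> a \<le> integral {a..b} (\<lambda>t. ?W * ?N t)"
      by (intro arc_estimate \<gamma>'(1-3) less_imp_le[OF \<open>a < b\<close>] cB w)
    also have "\<dots> = ?W * integral {a..b} ?N" by simp
    finally have "?\<Phi> b - ?\<Phi> a \<le> ?W * integral {a..b} ?N" .
    moreover have "((\<lambda>t. ?W * speed \<gamma> t) has_integral ?W * integral {a..b} ?N) {a..b}"
      using \<gamma>'(4) by (rule has_integral_mult_right)
    note has_integral_integrable[OF this] integral_unique[OF this]
    ultimately show "(\<lambda>t. ?W * speed \<gamma> t) integrable_on {a..b} \<and>
        ?\<Phi> b - ?\<Phi> a \<le> integral {a..b} (\<lambda>t. ?W * speed \<gamma> t)"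
      by (simp only:)
  qed
  then show ?thesis by (simp add: L2_length_speed)
qed

text \<open>A time that is no break point lies strictly between its two nearest break points, hence
  inside one arc.\<close>

lemma regular_times:
  assumes \<gamma>: "piecewise_C1_path A \<gamma>"
  obtains S where "finite S" "\<And>t. t \<in> {0..1} - S \<Longrightarrow> has_velocity A \<gamma> (velocity A \<gamma> t) t {0..1}"
proof -
  obtain T where T: "subdivision T"
    and arcs: "\<forall>a b. consecutive T a b \<longrightarrow> (\<exists>\<gamma>'. smooth_arc \<gamma> \<gamma>' a b)"
    using piecewise_C1_path_arcs[OF \<gamma>] by blast
  have "has_velocity A \<gamma> (velocity A \<gamma> t) t {0..1}" if t: "t \<in> {0..1} - T" for t
  proof -
    let ?L = "{s \<in> T. s < t}" and ?R = "{s \<in> T. t < s}"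
    have L: "finite ?L" "?L \<noteq> {}" and R: "finite ?R" "?R \<noteq> {}"
    proof -
      have "0 \<in> ?L" "1 \<in> ?R" using T t by (auto simp: subdivision_def order.order_iff_strict)
      then show "?L \<noteq> {}" "?R \<noteq> {}" by blast+
    qed (use T in \<open>auto simp: subdivision_def\<close>)
    have a: "Max ?L \<in> ?L" and b: "Min ?R \<in> ?R" using Max_in[OF L] Min_in[OF R] by blast+
    have "{Max ?L<..<Min ?R} \<inter> T = {}"
    proof (rule ccontr)
      assume "{Max ?L<..<Min ?R} \<inter> T \<noteq> {}"
      then obtain s where s: "s \<in> T" "Max ?L < s" "s < Min ?R" by auto
      have "s \<noteq> t" using s(1) t by blast
      then have "s < t \<or> t < s" by (auto simp: neq_iff)
      then show False using Max_ge[OF L(1), of s] Min_le[OF R(1), of s] s by auto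
    qed
    moreover have ab: "Max ?L \<in> T" "Max ?L < t" "Min ?R \<in> T" "t < Min ?R" using a b by blast+
    ultimately have "consecutive T (Max ?L) (Min ?R)" by (simp add: consecutive_def)
    then obtain \<gamma>' where "smooth_arc \<gamma> \<gamma>' (Max ?L) (Min ?R)" using arcs by blast
    then show ?thesis using ab(2,4) by (rule smooth_arcD(5))
  qed
  moreover have "finite T" using T by (simp add: subdivision_def)
  ultimately show thesis using that by blast
qed

text \<open>The speed gains the factor |m|, which cancels the 1 / |m| of the substitution. Negative
  m serves for reversal, m = 2 for the halves of a concatenation.\<close>

lemma affine_speed_has_integral:
  assumes \<gamma>: "piecewise_C1_path A \<gamma>" and m: "m \<noteq> 0" and ab: "{a..b} \<subseteq> {0..1}"
    and img: "(\<lambda>t. m * t + q) ` {a..b} = {0..1}"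
    and \<delta>: "\<And>t. t \<in> {a..b} \<Longrightarrow> \<delta> t = \<gamma> (m * t + q)"
  shows "(speed \<delta> has_integral L2_length A \<gamma>) {a..b}"
proof -
  obtain S where S: "finite S" "\<And>t. t \<in> {0..1} - S \<Longrightarrow> has_velocity A \<gamma> (velocity A \<gamma> t) t {0..1}"
    using regular_times[OF \<gamma>] by blast
  have into: "m * t + q \<in> {0..1}" if "t \<in> {a..b}" for t using img that by blast
  have "(\<lambda>x. (1 / m) *\<^sub>R x + - ((1 / m) *\<^sub>R q)) ` cbox 0 1 = {a..b}"
    unfolding cbox_interval img[symmetric] image_image using m by (simp add: field_simps)
  moreover have "(speed \<gamma> has_integral L2_length A \<gamma>) (cbox 0 1)"
    unfolding L2_length_speed cbox_interval using speed_integrable[OF \<gamma>] by (rule integrable_integral)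
  ultimately have "((\<lambda>t. speed \<gamma> (m * t + q)) has_integral (1 / \<bar>m\<bar>) * L2_length A \<gamma>) {a..b}"
    using has_integral_affinity[of "speed \<gamma>" "L2_length A \<gamma>" 0 1 m q] m by simp
  then have "((\<lambda>t. \<bar>m\<bar> * speed \<gamma> (m * t + q)) has_integral \<bar>m\<bar> * ((1 / \<bar>m\<bar>) * L2_length A \<gamma>)) {a..b}"
    by (rule has_integral_mult_right)
  then have "((\<lambda>t. \<bar>m\<bar> * speed \<gamma> (m * t + q)) has_integral L2_length A \<gamma>) {a..b}"
    using m by simp
  then show ?thesis
  \<comment> \<open>Left out are the ends, where a velocity within the subinterval need not be one
    within \<open>{0..1}\<close>, and the times sent to irregular times of \<gamma>.\<close>
  proof (rule has_integral_spike_finite[of "{a, b} \<union> {t. m * t + q \<in> S}", rotated 2])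
    show "finite ({a, b} \<union> {t. m * t + q \<in> S})" using finite_affine_preimage[OF m S(1)] by simp
    fix t assume t: "t \<in> {a..b} - ({a, b} \<union> {t. m * t + q \<in> S})"
    have t': "t \<in> {a..b}" "a < t" "t < b" "t \<in> {0..1}" using t ab by auto
    have "has_velocity A \<gamma> (velocity A \<gamma> (m * t + q)) (m * t + q) {0..1}"
      using S(2)[of "m * t + q"] t into[OF t'(1)] by auto
    from has_velocity_affine[OF m into this]
    have "has_velocity A \<delta> (\<lambda>c x. m *\<^sub>R velocity A \<gamma> (m * t + q) c x) t {a..b}"
      by (rule has_velocity_cong[rotated 2]) (use t' \<delta> in auto)
    from velocity_eqI[OF has_velocity_interior[OF ab t'(2,3) this] t'(4)]
    show "speed \<delta> t = \<bar>m\<bar> * speed \<gamma> (m * t + q)"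
      by (simp add: speed_def L2_norm_scale \<delta>[OF t'(1)])
  qed
qed

section \<open>Reversal, concatenation and segments\<close>

lemma reverse_path:
  assumes \<gamma>: "piecewise_C1_path A \<gamma>"
  shows "piecewise_C1_path A (\<lambda>t. \<gamma> (1 - t))" and "L2_length A (\<lambda>t. \<gamma> (1 - t)) = L2_length A \<gamma>"
proof -
  obtain T where T: "finite T" "{0, 1} \<subseteq> T" "T \<subseteq> {0..1}"
    and C1: "\<forall>a b. consecutive T a b \<longrightarrow> C1_curve_on A {a..b} \<gamma>"
    and metrics: "\<forall>t\<in>{0..1}. \<gamma> t \<in> riem_metrics A"
    using \<gamma> unfolding piecewise_C1_path_subdivision subdivision_def by blast
  let ?T = "(\<lambda>t. 1 - t) ` T"
  show "piecewise_C1_path A (\<lambda>t. \<gamma> (1 - t))"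
    unfolding piecewise_C1_path_subdivision
  proof (intro conjI exI[of _ ?T] ballI allI impI)
    show "\<gamma> (1 - t) \<in> riem_metrics A" if "t \<in> {0..1}" for t using that metrics by auto
    show "subdivision ?T"
      unfolding subdivision_def using T by (auto simp: image_iff intro: bexI[of _ 1] bexI[of _ 0])
    fix a b assume ab: "consecutive ?T a b"
    have "{1 - b<..<1 - a} \<inter> T = {}"
    proof (rule ccontr)
      assume "{1 - b<..<1 - a} \<inter> T \<noteq> {}"
      then obtain s where "s \<in> T" "1 - b < s" "s < 1 - a" by auto
      then have "1 - s \<in> {a<..<b} \<inter> ?T" by auto
      then show False using ab unfolding consecutive_def by blast
    qed
    then have "consecutive T (1 - b) (1 - a)" using ab by (auto simp: consecutive_def)
    then have "C1_curve_on A {1 - b..1 - a} \<gamma>" using C1 by blast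
    then show "C1_curve_on A {a..b} (\<lambda>t. \<gamma> (1 - t))"
      by (rule C1_curve_on_affine[where m = "-1" and q = 1, rotated 2]) auto
  qed
  have "(\<lambda>t. - 1 * t + 1) ` {0..1} = {0..1::real}"
    unfolding image_affinity_atLeastAtMost by simp
  then have "(speed (\<lambda>t. \<gamma> (1 - t)) has_integral L2_length A \<gamma>) {0..1}"
    by (intro affine_speed_has_integral[OF \<gamma>, where m = "-1" and q = 1]) auto
  then show "L2_length A (\<lambda>t. \<gamma> (1 - t)) = L2_length A \<gamma>"
    unfolding L2_length_speed[of "\<lambda>t. \<gamma> (1 - t)"] by (rule integral_unique)
qed

lemma join_paths:
  fixes \<gamma> \<delta>
  assumes \<gamma>: "piecewise_C1_path A \<gamma>" and \<delta>: "piecewise_C1_path A \<delta>" and eq: "\<gamma> 1 = \<delta> 0"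
  defines "\<epsilon> \<equiv> \<lambda>t. if t \<le> 1 / 2 then \<gamma> (2 * t) else \<delta> (2 * t - 1)"
  shows "piecewise_C1_path A \<epsilon>" and "L2_length A \<epsilon> = L2_length A \<gamma> + L2_length A \<delta>"
proof -
  have left: "\<epsilon> t = \<gamma> (2 * t + 0)" if "t \<le> 1 / 2" for t using that by (simp add: \<epsilon>_def)
  \<comment> \<open>At 1/2 the left branch is in force; the matching end points make the right
    formula valid on the closed right half.\<close>
  have right: "\<epsilon> t = \<delta> (2 * t + -1)" if "1 / 2 \<le> t" for t
  proof (cases "t = 1 / 2")
    case True
    show ?thesis unfolding True \<epsilon>_def using eq by simp
  qed (use that in \<open>simp add: \<epsilon>_def\<close>)
  obtain T where T: "finite T" "{0, 1} \<subseteq> T" "T \<subseteq> {0..1}"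
    and C1: "\<forall>a b. consecutive T a b \<longrightarrow> C1_curve_on A {a..b} \<gamma>"
    and metrics: "\<forall>t\<in>{0..1}. \<gamma> t \<in> riem_metrics A"
    using \<gamma> unfolding piecewise_C1_path_subdivision subdivision_def by blast
  obtain T' where T': "finite T'" "{0, 1} \<subseteq> T'" "T' \<subseteq> {0..1}"
    and C1': "\<forall>a b. consecutive T' a b \<longrightarrow> C1_curve_on A {a..b} \<delta>"
    and metrics': "\<forall>t\<in>{0..1}. \<delta> t \<in> riem_metrics A"
    using \<delta> unfolding piecewise_C1_path_subdivision subdivision_def by blast
  \<comment> \<open>Both subdivisions rescaled, in the shape \<open>m * t + q\<close> of the affine
    lemmas; the midpoint belongs to both parts.\<close>
  let ?U = "{t. 2 * t + 0 \<in> T} \<union> {t. 2 * t + -1 \<in> T'}"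
  show "piecewise_C1_path A \<epsilon>"
    unfolding piecewise_C1_path_subdivision
  proof (intro conjI exI[of _ ?U] ballI allI impI)
    show "\<epsilon> t \<in> riem_metrics A" if "t \<in> {0..1}" for t
      using that metrics metrics' unfolding \<epsilon>_def by auto
    have "finite ?U"
      using finite_affine_preimage[OF _ T(1), of 2 0] finite_affine_preimage[OF _ T'(1), of 2 "-1"] by simp
    moreover have "{0, 1} \<subseteq> ?U" "?U \<subseteq> {0..1}" using T T' by force+
    ultimately show "subdivision ?U" by (simp add: subdivision_def)
    fix a b assume "consecutive ?U a b"
    then have ab: "a \<in> ?U" "b \<in> ?U" "a < b \<and> {a<..<b} \<inter> ?U = {}" by (auto simp: consecutive_def)
    have half: "1 / 2 \<in> ?U" using T(2) by auto
    have gap: "s \<notin> ?U" if "a < s" "s < b" for s using ab(3) that by auto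
    \<comment> \<open>The midpoint is a break point, so no consecutive interval straddles
      it.\<close>
    consider "b \<le> 1 / 2" | "1 / 2 \<le> a" using gap[OF _ _] half by (metis linorder_not_le)
    then show "C1_curve_on A {a..b} \<epsilon>"
    proof cases
      case 1
      \<comment> \<open>A point of the left half that stems from \<open>T'\<close> can only be 1/2,
        and 1 lies in \<open>T\<close>.\<close>
      have mem: "2 * t + 0 \<in> T" if "t \<in> ?U" "t \<le> 1 / 2" for t
        using that T'(3) T(2) by (cases "t = 1 / 2") force+
      have "{2 * a + 0<..<2 * b + 0} \<inter> T = {}"
      proof (rule ccontr)
        assume "{2 * a + 0<..<2 * b + 0} \<inter> T \<noteq> {}"
        then obtain s where "s \<in> T" "2 * a < s" "s < 2 * b" by auto
        then show False using gap[of "s / 2"] by auto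
      qed
      then have "consecutive T (2 * a + 0) (2 * b + 0)"
        using ab 1 mem[of a] mem[of b] by (simp add: consecutive_def)
      then have "C1_curve_on A {2 * a + 0..2 * b + 0} \<gamma>" using C1 by blast
      then show ?thesis
        by (rule C1_curve_on_affine[where m = 2 and q = 0, rotated 2]) (use 1 left in auto)
    next
      case 2
      have mem: "2 * t + -1 \<in> T'" if "t \<in> ?U" "1 / 2 \<le> t" for t
        using that T(3) T'(2) by (cases "t = 1 / 2") force+
      have "{2 * a + -1<..<2 * b + -1} \<inter> T' = {}"
      proof (rule ccontr)
        assume "{2 * a + -1<..<2 * b + -1} \<inter> T' \<noteq> {}"
        then obtain s where "s \<in> T'" "2 * a - 1 < s" "s < 2 * b - 1" by auto
        then show False using gap[of "(s + 1) / 2"] by (auto simp: field_simps)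
      qed
      then have "consecutive T' (2 * a + -1) (2 * b + -1)"
        using ab 2 mem[of a] mem[of b] by (simp add: consecutive_def)
      then have "C1_curve_on A {2 * a + -1..2 * b + -1} \<delta>" using C1' by blast
      then show ?thesis
        by (rule C1_curve_on_affine[where m = 2 and q = "-1", rotated 2]) (use 2 right in auto)
    qed
  qed
  have "(\<lambda>t. 2 * t + 0) ` {0..1/2} = {0..1::real}"
    unfolding image_affinity_atLeastAtMost by simp
  then have "(speed \<epsilon> has_integral L2_length A \<gamma>) {0..1/2}"
    by (intro affine_speed_has_integral[OF \<gamma>, where m = 2 and q = 0]) (use left in auto)
  moreover have "(\<lambda>t. 2 * t + -1) ` {1/2..1} = {0..1::real}"
    unfolding image_affinity_atLeastAtMost by simp
  then have "(speed \<epsilon> has_integral L2_length A \<delta>) {1/2..1}"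
    by (intro affine_speed_has_integral[OF \<delta>, where m = 2 and q = "-1"]) (use right in auto)
  ultimately have "(speed \<epsilon> has_integral L2_length A \<gamma> + L2_length A \<delta>) {0..1}"
    by (intro has_integral_combine[of 0 "1/2" 1]) auto
  then show "L2_length A \<epsilon> = L2_length A \<gamma> + L2_length A \<delta>"
    unfolding L2_length_speed[of \<epsilon>] by (rule integral_unique)
qed

text \<open>The difference quotients are g1 - g0 for every s other than t, so the limit is that of a
  constant.\<close>

lemma straight_path_velocity:
  assumes "g0 \<in> sym_tensor_fields A" "g1 \<in> sym_tensor_fields A"
  shows "has_velocity A (\<lambda>t c x. (1 - t) *\<^sub>R g0 c x + t *\<^sub>R g1 c x) (\<lambda>c x. g1 c x - g0 c x) t I"
proof -
  have "(\<lambda>c x. g1 c x - g0 c x) \<in> sym_tensor_fields A"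
    using sym_tensor_fields_linear[OF assms(2,1), of 1 "-1"] by simp
  then have const: "limitin (smooth_topology A) (\<lambda>s. \<lambda>c x. g1 c x - g0 c x) (\<lambda>c x. g1 c x - g0 c x) (at t within I)"
    by (simp add: limitin_const_iff topspace_smooth_topology)
  have "eventually (\<lambda>s. s \<noteq> t) (at t within I)" by (simp add: eventually_at_filter)
  then have "eventually (\<lambda>s. (\<lambda>c x. g1 c x - g0 c x) =
      (\<lambda>c x. ((1 - s) *\<^sub>R g0 c x + s *\<^sub>R g1 c x - ((1 - t) *\<^sub>R g0 c x + t *\<^sub>R g1 c x)) /\<^sub>R (s - t)))
      (at t within I)"
  proof eventually_elim
    case (elim s)
    have "(1 - s) *\<^sub>R x + s *\<^sub>R y - ((1 - t) *\<^sub>R x + t *\<^sub>R y) = (s - t) *\<^sub>R (y - x)"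
      for x y :: "real ^ 'n ^ 'n" by (simp add: algebra_simps)
    then show ?case using elim by simp
  qed
  from limitin_transform_eventually[OF this const] show ?thesis
    unfolding has_velocity_def .
qed

lemma straight_path:
  assumes g: "g0 \<in> riem_metrics A" "g1 \<in> riem_metrics A"
  shows "piecewise_C1_path A (\<lambda>t c x. (1 - t) *\<^sub>R g0 c x + t *\<^sub>R g1 c x)"
  unfolding piecewise_C1_path_def
proof (intro conjI exI[of _ "{0, 1}"] ballI impI)
  note sym = riem_metrics_sym[OF g(1)] riem_metrics_sym[OF g(2)]
  fix t :: real assume t: "t \<in> {0..1}"
  have "spd ((1 - t) *\<^sub>R g0 c x + t *\<^sub>R g1 c x)" if "c \<in> A" "x \<in> coord_image c" for c x
    using t that by (intro spd_convex riem_metrics_spd[OF g(1)] riem_metrics_spd[OF g(2)]) auto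
  then show "(\<lambda>c x. (1 - t) *\<^sub>R g0 c x + t *\<^sub>R g1 c x) \<in> riem_metrics A"
    using sym_tensor_fields_linear[OF sym] by (auto simp: riem_metrics_def spd_def)
next
  fix a b :: real
  note sym = riem_metrics_sym[OF g(1)] riem_metrics_sym[OF g(2)]
  have "continuous_map (top_of_set {a..b}) (smooth_topology A) (\<lambda>t c x. g1 c x - g0 c x)"
    using has_velocity_sym[OF straight_path_velocity[OF sym]]
    by (simp add: topspace_smooth_topology)
  then show "C1_curve_on A {a..b} (\<lambda>t c x. (1 - t) *\<^sub>R g0 c x + t *\<^sub>R g1 c x)"
    unfolding C1_curve_on_def using straight_path_velocity[OF sym]
    by (intro exI[of _ "\<lambda>t c x. g1 c x - g0 c x"]) simp
qed auto

text \<open>The constant path is written as a degenerate segment so that the velocity of segments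
  applies; its zero velocity is treated as 0 times g.\<close>

lemma constant_path_length:
  assumes g: "g \<in> riem_metrics A"
  shows "L2_length A (\<lambda>t c x. (1 - t) *\<^sub>R g c x + t *\<^sub>R g c x) = 0"
proof -
  have "speed (\<lambda>t c x. (1 - t) *\<^sub>R g c x + t *\<^sub>R g c x) t = 0" if "t \<in> {0..1}" for t
    using velocity_eqI[OF straight_path_velocity[OF riem_metrics_sym[OF g] riem_metrics_sym[OF g]] that]
      L2_norm_scale[of _ 0 g]
    by (simp add: speed_def)
  then show ?thesis unfolding L2_length_speed by (subst integral_cong[of _ _ "\<lambda>_. 0"]) auto
qed

section \<open>The infimum of lengths and its positivity\<close>

definition path_lengths where
  "path_lengths g0 g1 = {L2_length A \<gamma> | \<gamma>. piecewise_C1_path A \<gamma> \<and> \<gamma> 0 = g0 \<and> \<gamma> 1 = g1}"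

lemma L2_dist_path_lengths:
  "g0 \<in> riem_metrics A \<Longrightarrow> g1 \<in> riem_metrics A \<Longrightarrow> L2_dist A g0 g1 = Inf (path_lengths g0 g1)"
  by (simp add: L2_dist_def path_lengths_def)

lemma path_lengths_nonempty:
  assumes "g0 \<in> riem_metrics A" "g1 \<in> riem_metrics A"
  shows "path_lengths g0 g1 \<noteq> {}"
proof -
  have "L2_length A (\<lambda>t c x. (1 - t) *\<^sub>R g0 c x + t *\<^sub>R g1 c x) \<in> path_lengths g0 g1"
    unfolding path_lengths_def using straight_path[OF assms]
    by (intro CollectI exI[of _ "\<lambda>t c x. (1 - t) *\<^sub>R g0 c x + t *\<^sub>R g1 c x"]) simp
  then show ?thesis by blast
qed

lemma path_lengths_nonneg: "l \<in> path_lengths g0 g1 \<Longrightarrow> 0 \<le> l"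
  by (auto simp: path_lengths_def L2_length_nonneg)

lemma bdd_below_path_lengths: "bdd_below (path_lengths g0 g1)"
  using path_lengths_nonneg by (rule bdd_belowI)

lemma path_lengths_sym_subset: "path_lengths g0 g1 \<subseteq> path_lengths g1 g0"
proof
  fix l assume "l \<in> path_lengths g0 g1"
  then obtain \<gamma> where "piecewise_C1_path A \<gamma>" "\<gamma> 0 = g0" "\<gamma> 1 = g1" "l = L2_length A \<gamma>"
    by (auto simp: path_lengths_def)
  then show "l \<in> path_lengths g1 g0"
    unfolding path_lengths_def using reverse_path[of \<gamma>]
    by (intro CollectI exI[of _ "\<lambda>t. \<gamma> (1 - t)"]) simp
qed

lemma path_lengths_add:
  assumes "l \<in> path_lengths g0 g1" "l' \<in> path_lengths g1 g2"
  shows "l + l' \<in> path_lengths g0 g2"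
proof -
  obtain \<gamma> where \<gamma>: "piecewise_C1_path A \<gamma>" "\<gamma> 0 = g0" "\<gamma> 1 = g1" "l = L2_length A \<gamma>"
    using assms(1) by (auto simp: path_lengths_def)
  obtain \<delta> where \<delta>: "piecewise_C1_path A \<delta>" "\<delta> 0 = g1" "\<delta> 1 = g2" "l' = L2_length A \<delta>"
    using assms(2) by (auto simp: path_lengths_def)
  have "\<gamma> 1 = \<delta> 0" using \<gamma> \<delta> by simp
  from join_paths[OF \<gamma>(1) \<delta>(1) this] show ?thesis
    unfolding path_lengths_def using \<gamma> \<delta>
    by (intro CollectI exI[of _ "\<lambda>t. if t \<le> 1 / 2 then \<gamma> (2 * t) else \<delta> (2 * t - 1)"]) simp
qed

text \<open>With the weight w equal to the difference of \<open>sep_fun v\<close> at the ends and W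
  its L2 norm on the piece, the path estimate reads W^2 \<le> W sqrt(n + 2) l. So W / sqrt(n + 2)
  bounds all lengths from below, hence the distance.\<close>

lemma negligible_differing_sep_fun:
  assumes g: "g0 \<in> riem_metrics A" "g1 \<in> riem_metrics A" and d: "L2_dist A g0 g1 = 0"
    and cB: "(c, B) \<in> pieces"
  shows "negligible {x \<in> snd c ` B. sep_fun v (g0 c x) \<noteq> sep_fun v (g1 c x)}"
proof -
  define E where "E = snd c ` B"
  define w where "w x = sep_fun v (g1 c x) - sep_fun v (g0 c x)" for x
  define W where "W = sqrt (LINT x:E|lborel. (w x)\<^sup>2)"
  note c = pieces_chart[OF cB] and K = piece_compact_subset[OF cB]
  have cont: "continuous_on (snd c ` closure B) (\<lambda>x. sep_fun v (g c x))" if "g \<in> riem_metrics A" for g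
    using K by (intro continuous_on_sep_fun riem_metrics_spd[OF that c]
        continuous_on_subset[OF sym_tensor_fields_continuous[OF riem_metrics_sym[OF that] c]]) auto
  have cw: "continuous_on (snd c ` closure B) w"
    unfolding w_def by (intro continuous_on_diff cont g)
  note i = set_integrable_compact_subset[OF piece_compact[OF cB] _ piece_borel[OF cB] piece_subset, folded E_def]
  have int: "set_integrable lborel E (\<lambda>x. (w x)\<^sup>2)" by (intro i continuous_intros cw)
  have pos: "0 \<le> (LINT x:E|lborel. (w x)\<^sup>2)" by (intro set_integral_nonneg_lborel) simp
  then have W: "0 \<le> W" "W * W = (LINT x:E|lborel. (w x)\<^sup>2)" by (simp_all add: W_def)
  have "W / sqrt (CARD('n) + 2) \<le> l" if l: "l \<in> path_lengths g0 g1" for l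
  proof -
    obtain \<gamma> where \<gamma>: "piecewise_C1_path A \<gamma>" "\<gamma> 0 = g0" "\<gamma> 1 = g1" "l = L2_length A \<gamma>"
      using l by (auto simp: path_lengths_def)
    have "W * W = (LINT x:E|lborel. w x * sep_fun v (g1 c x) - w x * sep_fun v (g0 c x))"
      unfolding W(2) by (simp add: w_def power2_eq_square right_diff_distrib)
    also have "\<dots> = (LINT x:E|lborel. w x * sep_fun v (g1 c x)) - (LINT x:E|lborel. w x * sep_fun v (g0 c x))"
      by (intro set_integral_diff(2) i continuous_intros cw cont g)
    also have "\<dots> \<le> W * sqrt (CARD('n) + 2) * l"
      using path_estimate[OF \<gamma>(1) cB cw, of v] unfolding \<gamma>(2-4) W_def E_def .
    finally have "W * W \<le> W * (sqrt (CARD('n) + 2) * l)" by (simp add: mult.assoc)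
    \<comment> \<open>Cancelling W requires W > 0; for W = 0 the claim is nonnegativity of the
      length.\<close>
    then have "W \<le> sqrt (CARD('n) + 2) * l"
      using W(1) L2_length_nonneg[OF \<gamma>(1)] \<gamma>(4) by (cases "W = 0") auto
    then show ?thesis by (simp add: divide_le_eq mult.commute)
  qed
  then have "W / sqrt (CARD('n) + 2) \<le> L2_dist A g0 g1"
    unfolding L2_dist_path_lengths[OF g] by (intro cInf_greatest path_lengths_nonempty g)
  then have "W = 0" using d W(1) by (simp add: divide_le_0_iff)
  then have "(LINT x|lborel. indicator E x *\<^sub>R (w x)\<^sup>2) = 0"
    using W(2) unfolding set_lebesgue_integral_def by simp
  \<comment> \<open>Integrability from \<open>int\<close> matters here: the Bochner integral of a
    non-integrable function is 0 as well.\<close>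
  then have "AE x in lborel. indicator E x *\<^sub>R (w x)\<^sup>2 = 0"
    using integral_nonneg_eq_0_iff_AE[OF int[unfolded set_integrable_def]] by simp
  then obtain N where N: "{x \<in> space lborel. indicator E x *\<^sub>R (w x)\<^sup>2 \<noteq> 0} \<subseteq> N" "N \<in> null_sets lborel"
    by (auto elim!: AE_E simp: null_sets_def)
  have "negligible N" using N(2) by (simp add: negligible_iff_null_sets null_sets_completionI)
  then show ?thesis
    by (rule negligible_subset) (use N(1) in \<open>auto simp: w_def E_def indicator_def\<close>)
qed

text \<open>Metrics that differ at a point are separated there by one of finitely many vectors, 0
  and e_i + e_j, so a finite union of null sets covers the difference.\<close>

lemma negligible_differing_metrics:
  assumes g: "g0 \<in> riem_metrics A" "g1 \<in> riem_metrics A" and d: "L2_dist A g0 g1 = 0"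
    and cB: "(c, B) \<in> pieces"
  shows "negligible {x \<in> snd c ` B. g0 c x \<noteq> g1 c x}"
proof -
  let ?V = "insert 0 (range (\<lambda>(i, j). axis i 1 + axis j 1)) :: (real ^ 'n) set"
  let ?N = "\<lambda>v. {x \<in> snd c ` B. sep_fun v (g0 c x) \<noteq> sep_fun v (g1 c x)}"
  have "negligible (\<Union>v\<in>?V. ?N v)"
    by (rule negligible_Union) (auto intro: negligible_differing_sep_fun[OF g d cB])
  moreover have "{x \<in> snd c ` B. g0 c x \<noteq> g1 c x} \<subseteq> (\<Union>v\<in>?V. ?N v)"
  proof clarify
    fix p assume p: "p \<in> B" and ne: "g0 c (snd c p) \<noteq> g1 c (snd c p)"
    have x: "snd c p \<in> coord_image c"
      using p by (intro subsetD[OF piece_compact_subset[OF cB]] subsetD[OF piece_subset]) auto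
    have "\<exists>v\<in>?V. sep_fun v (g0 c (snd c p)) \<noteq> sep_fun v (g1 c (snd c p))"
    proof (rule ccontr)
      assume "\<not> ?thesis"
      then have "g0 c (snd c p) = g1 c (snd c p)"
        by (intro sep_fun_separates riem_metrics_spd[OF _ pieces_chart[OF cB] x] g) auto
      then show False using ne by simp
    qed
    then show "snd c p \<in> (\<Union>v\<in>?V. ?N v)" using p by blast
  qed
  ultimately show ?thesis by (rule negligible_subset)
qed

text \<open>Transition maps send null sets to null sets, so the comparison on the pieces, each in its own
  chart, is enough to see that the set where the metrics differ is null in every chart.\<close>

lemma L2_dist_eq_0_imp_eq:
  assumes g: "g0 \<in> riem_metrics A" "g1 \<in> riem_metrics A" and d: "L2_dist A g0 g1 = 0"
  shows "g0 = g1"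
proof (intro ext)
  fix c x
  note sym = riem_metrics_sym[OF g(1)] riem_metrics_sym[OF g(2)]
  show "g0 c x = g1 c x"
  proof (cases "c \<in> A \<and> x \<in> coord_image c")
    case False
    then show ?thesis using sym_tensor_fields_zero[OF sym(1)] sym_tensor_fields_zero[OF sym(2)] by simp
  next
    case True
    then have c: "c \<in> A" and x: "x \<in> coord_image c" by auto
    \<comment> \<open>The set of disagreement in this chart; it is open by continuity and will be
      shown null.\<close>
    define V where "V = coord_image c \<inter> (\<lambda>y. g0 c y - g1 c y) -` (- {0})"
    have "open V"
      unfolding V_def
      by (intro continuous_open_preimage continuous_on_diff sym_tensor_fields_continuous[OF sym(1) c]
          sym_tensor_fields_continuous[OF sym(2) c] open_coord_image c) auto
    define D where "D = (\<lambda>(c', B). {y \<in> snd c' ` B. g0 c' y \<noteq> g1 c' y} \<inter> overlap c' c)"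
    have "negligible (transition c' c ` D (c', B))" if cB: "(c', B) \<in> pieces" for c' B
    proof (rule negligible_differentiable_image_negligible)
      show "negligible (D (c', B))"
        unfolding D_def by (auto intro: negligible_subset[OF negligible_differing_metrics[OF g d cB]])
      show "transition c' c differentiable_on D (c', B)"
        unfolding differentiable_on_def D_def
        using smooth_on_imp_differentiable[OF smooth_transition[OF pieces_chart[OF cB] c]]
        by (auto intro: differentiable_at_withinI)
    qed simp
    then have "negligible (\<Union>p\<in>pieces. transition (fst p) c ` D p)"
      by (intro negligible_Union) (auto simp: finite_pieces)
    \<comment> \<open>A point of V lies in some piece, and its coordinates in the chart of that
      piece are carried back to it by the transition map.\<close>
    moreover have "V \<subseteq> (\<Union>p\<in>pieces. transition (fst p) c ` D p)"
    proof
      fix y assume "y \<in> V"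
      then obtain p where p: "p \<in> fst c" "y = snd c p" and ne: "g0 c y \<noteq> g1 c y"
        by (auto simp: V_def coord_image_def)
      obtain c' B where cB: "(c', B) \<in> pieces" "p \<in> B" using pieces_cover by blast
      note c' = pieces_chart[OF cB(1)]
      have p': "p \<in> fst c'" using pieces_closure[OF cB(1)] closure_subset cB(2) by blast
      have tr: "transition c' c (snd c' p) = y" "transition c c' y = snd c' p"
        unfolding transition_def o_def p(2) inv_chart[OF c p(1)] inv_chart[OF c' p'] by simp_all
      have ov: "y \<in> overlap c c'" "snd c' p \<in> overlap c' c"
        unfolding overlap_def p(2) using p(1) p' by auto
      \<comment> \<open>The transformation law would carry equal components in c' to equal
        components in c.\<close>
      have "g0 c' (snd c' p) \<noteq> g1 c' (snd c' p)"
        using ne sym_tensor_fields_transform[OF sym(1) c c' ov(1)]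
          sym_tensor_fields_transform[OF sym(2) c c' ov(1)] unfolding tr by metis
      then have "snd c' p \<in> D (c', B)" unfolding D_def using cB(2) ov(2) by auto
      then show "y \<in> (\<Union>p\<in>pieces. transition (fst p) c ` D p)"
        using cB(1) tr(1) by (intro UN_I[of "(c', B)"]) auto
    qed
    ultimately have "negligible V" by (rule negligible_subset)
    \<comment> \<open>A nonempty open set has positive measure; this upgrades equality almost
      everywhere to equality.\<close>
    then have "V = {}" using open_not_negligible[OF \<open>open V\<close>] by blast
    then show ?thesis using x by (auto simp: V_def)
  qed
qed

lemma Metric_space_L2_dist: "Metric_space (riem_metrics A) (L2_dist A)"
proof
  fix x y
  \<comment> \<open>Here x and y are arbitrary; off the metrics the value is 0 by
    convention.\<close>
  show "0 \<le> L2_dist A x y"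
    unfolding L2_dist_def path_lengths_def[symmetric]
    using path_lengths_nonempty path_lengths_nonneg by (auto intro: cInf_greatest)
  have "path_lengths x y = path_lengths y x" using path_lengths_sym_subset by blast
  then show "L2_dist A x y = L2_dist A y x"
    unfolding L2_dist_def path_lengths_def[symmetric] by simp
next
  fix x y assume xy: "x \<in> riem_metrics A" "y \<in> riem_metrics A"
  show "L2_dist A x y = 0 \<longleftrightarrow> x = y"
  proof
    assume "x = y"
    have "0 \<in> path_lengths x x"
      unfolding path_lengths_def
      using straight_path[OF xy(1) xy(1)] constant_path_length[OF xy(1)]
      by (intro CollectI exI[of _ "\<lambda>t c z. (1 - t) *\<^sub>R x c z + t *\<^sub>R x c z"]) simp
    then have "L2_dist A x x = 0"
      unfolding L2_dist_path_lengths[OF xy(1) xy(1)] by (rule cInf_eq_minimum) (rule path_lengths_nonneg)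
    then show "L2_dist A x y = 0" using \<open>x = y\<close> by simp
  qed (rule L2_dist_eq_0_imp_eq[OF xy])
next
  fix x y z assume xyz: "x \<in> riem_metrics A" "y \<in> riem_metrics A" "z \<in> riem_metrics A"
  \<comment> \<open>Concatenation bounds the distance for each pair of lengths; the infimum is then
    taken over l with l' fixed, and afterwards over l'.\<close>
  have "L2_dist A x z \<le> l + l'" if "l \<in> path_lengths x y" "l' \<in> path_lengths y z" for l l'
    unfolding L2_dist_path_lengths[OF xyz(1,3)]
    by (intro cInf_lower path_lengths_add[OF that] bdd_below_path_lengths)
  then have "L2_dist A x z - l' \<le> L2_dist A x y" if "l' \<in> path_lengths y z" for l'
    unfolding L2_dist_path_lengths[OF xyz(1,2)] using that
    by (intro cInf_greatest path_lengths_nonempty xyz) (simp add: diff_le_eq)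
  then have "L2_dist A x z - L2_dist A x y \<le> L2_dist A y z"
    unfolding L2_dist_path_lengths[OF xyz(2,3)]
    by (intro cInf_greatest path_lengths_nonempty xyz) (simp add: diff_le_eq add.commute)
  then show "L2_dist A x z \<le> L2_dist A x y + L2_dist A y z" by simp
qed

end

theorem theorem3p9:
  fixes A :: "('a::{t2_space, second_countable_topology}, 'n::finite) chart set"
  assumes "compact (UNIV :: 'a set)"
    and "oriented_smooth_atlas A"
  shows "Metric_space (riem_metrics A) (L2_dist A) \<and>
    (\<forall>g0\<in>riem_metrics A. \<forall>g1\<in>riem_metrics A. g0 \<noteq> g1 \<longrightarrow> L2_dist A g0 g1 > 0)"
proof -
  interpret closed_manifold A by unfold_locales (rule assms)+
  interpret Metric_space "riem_metrics A" "L2_dist A" by (rule Metric_space_L2_dist)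
  show ?thesis using Metric_space_L2_dist mdist_pos_less by blast
qed

end
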